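(* (i) The Slater orbit and the Dixon--Watson--Whipple orbit intersect improperly. (ii) For all integers $n\ge1$, the Slater orbit and the Pfaff--Saalschütz orbit of index $n$ do not intersect improperly. (iii) For all integers $n\ge1$, the Dixon--Watson--Whipple orbit and the Pfaff--Saalschütz orbit of index $n$ do not intersect improperly.
   Context: Points of $\mathbb{C}^3\times\mathbb{C}^2$ are written $(a,b,c;d,e)$. The Thomae group $\mathfrak{T}\subset GL(5,\mathbb{C})$, isomorphic to $S_5$, is defined as follows. Introduce new linear coordinates $(x,y,z;u,v)$ on $\mathbb{C}^3\times\mathbb{C}^2$ by $(a,b,c;d,e)=(x,y,z;u,v)A$ (row vectors), with $$A=\begin{pmatrix}1&0&0&1&1\\0&1&0&1&1\\0&0&1&1&1\\1&1&1&2&1\\1&1&1&1&2\end{pmatrix}.$$ $\mathfrak{T}$ is the group of linear transformations of $\mathbb{C}^3\times\mathbb{C}^2$ induced by all $5!$ permutations of the five coordinates $x,y,z,u,v$. The orbits (each is the set of images $T\mathcal{V}$, $T\in\mathfrak{T}$, of the indicated $3$-dimensional variety $\mathcal{V}$): Slater orbit: the $\mathfrak{T}$-orbit of $\{ab+bc+ca=(d-1)(e-1),\ d+e-a-b-c=2\}$. Dixon--Watson--Whipple orbit: the $\mathfrak{T}$-orbit of the $3$-plane $\{d=1+a-b,\ e=1+a-c\}$. Pfaff--Saalschütz orbit of index $n$: the $\mathfrak{T}$-orbit of the $3$-plane $\{a=-n,\ d+e-a-b-c=1\}$. Improper intersection: if $\mathcal{X},\mathcal{Y}\subset\mathbb{C}^3\times\mathbb{C}^2$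 are irreducible varieties of dimensions $m,n$ with $m+n\ge5$, each component of $\mathcal{X}\cap\mathcal{Y}$, if it is non-empty, has dimension at least $m+n-5$; $\mathcal{X}$ and $\mathcal{Y}$ intersect improperly if $\mathcal{X}\cap\mathcal{Y}$ is non-empty and some component has dimension strictly greater than $m+n-5$ (so for two $3$-dimensional varieties, some component has dimension greater than $1$). Two $\mathfrak{T}$-orbits $\mathfrak{V},\mathfrak{W}$ of varieties intersect improperly iff there is at least one $\mathcal{V}\in\mathfrak{V}$ and one $\mathcal{W}\in\mathfrak{W}$ that intersect improperly. *)

theory Defs
  imports "HOL-Analysis.Analysis"
begin

section \<open>Affine varieties in \<open>\<complex>\<^sup>n\<close>\<close>

text \<open>Since \<open>\<complex>\<close> is infinite, polynomials in \<open>n\<close> variables are identified with the functions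
  they induce on \<open>\<complex>\<^sup>n\<close>.\<close>

inductive polynomial_fun :: "(complex^'n \<Rightarrow> complex) \<Rightarrow> bool" where
  const: "polynomial_fun (\<lambda>p. k)"
| coord: "polynomial_fun (\<lambda>p. p $ i)"
| add: "polynomial_fun f \<Longrightarrow> polynomial_fun g \<Longrightarrow> polynomial_fun (\<lambda>p. f p + g p)"
| mult: "polynomial_fun f \<Longrightarrow> polynomial_fun g \<Longrightarrow> polynomial_fun (\<lambda>p. f p * g p)"

definition zariski_closed :: "(complex^'n) set \<Rightarrow> bool" where
  "zariski_closed X \<longleftrightarrow> (\<exists>F. (\<forall>f\<in>F. polynomial_fun f) \<and> X = {p. \<forall>f\<in>F. f p = 0})"

definition irreducible_variety :: "(complex^'n) set \<Rightarrow> bool" where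
  "irreducible_variety X \<longleftrightarrow> zariski_closed X \<and> X \<noteq> {} \<and>
     (\<forall>Y Z. zariski_closed Y \<longrightarrow> zariski_closed Z \<longrightarrow> X = Y \<union> Z \<longrightarrow> X = Y \<or> X = Z)"

definition irreducible_component :: "(complex^'n) set \<Rightarrow> (complex^'n) set \<Rightarrow> bool" where
  "irreducible_component Z X \<longleftrightarrow> irreducible_variety Z \<and> Z \<subseteq> X \<and>
     (\<forall>Z'. irreducible_variety Z' \<longrightarrow> Z \<subseteq> Z' \<longrightarrow> Z' \<subseteq> X \<longrightarrow> Z' = Z)"

text \<open>Krull dimension of a Zariski closed set: the supremum of the lengths \<open>m\<close> of chains
  \<open>C\<^sub>0 \<subset> C\<^sub>1 \<subset> \<dots> \<subset> C\<^sub>m\<close> of irreducible closed subsets.  (The empty set gets dimension \<open>0\<close>; it is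
  never measured below.)\<close>

definition dim_variety :: "(complex^'n) set \<Rightarrow> enat" where
  "dim_variety X = Sup {enat m | m. \<exists>C :: nat \<Rightarrow> (complex^'n) set.
     (\<forall>i\<le>m. irreducible_variety (C i) \<and> C i \<subseteq> X) \<and> (\<forall>i<m. C i \<subset> C (Suc i))}"


section \<open>Improper intersection in \<open>\<complex>\<^sup>5\<close>\<close>

text \<open>The last condition is \<open>dim Z > dim X + dim Y - 5\<close>, written without subtraction.\<close>

definition intersect_improperly :: "(complex^5) set \<Rightarrow> (complex^5) set \<Rightarrow> bool" where
  "intersect_improperly X Y \<longleftrightarrow>
     irreducible_variety X \<and> irreducible_variety Y \<and> dim_variety X + dim_variety Y \<ge> 5 \<and>
     X \<inter> Y \<noteq> {} \<and>
     (\<exists>Z. irreducible_component Z (X \<inter> Y) \<and> dim_variety X + dim_variety Y < dim_variety Z + 5)"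

definition orbits_intersect_improperly ::
    "(complex^5) set set \<Rightarrow> (complex^5) set set \<Rightarrow> bool" where
  "orbits_intersect_improperly VV WW \<longleftrightarrow> (\<exists>V\<in>VV. \<exists>W\<in>WW. intersect_improperly V W)"


section \<open>The Thomae group and the three orbits\<close>

text \<open>A point \<open>(a,b,c;d,e)\<close> of \<open>\<complex>\<^sup>3 \<times> \<complex>\<^sup>2\<close> is the row vector \<open>p :: complex^5\<close> with
  \<open>a = p $ 1, \<dots>, e = p $ 5\<close>; its coordinates \<open>w = (x,y,z;u,v)\<close> satisfy \<open>p = w v* thomae_matrix\<close>.\<close>

definition thomae_matrix :: "complex^5^5" where
  "thomae_matrix = vector
     [vector [1, 0, 0, 1, 1],
      vector [0, 1, 0, 1, 1],
      vector [0, 0, 1, 1, 1],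
      vector [1, 1, 1, 2, 1],
      vector [1, 1, 1, 1, 2]]"

lemma UNIV_5: "(UNIV :: 5 set) = {1, 2, 3, 4, 5}"
proof (rule sym, rule card_subset_eq)
  have "distinct [1, 2, 3, 4, 5 :: 5]"
    by simp
  then have "card (set [1, 2, 3, 4, 5 :: 5]) = length [1, 2, 3, 4, 5 :: 5]"
    by (rule distinct_card)
  then show "card {1, 2, 3, 4, 5 :: 5} = card (UNIV :: 5 set)"
    by simp
qed auto

lemma sum_5: "sum f (UNIV :: 5 set) = f 1 + f 2 + f 3 + f 4 + f 5"
  unfolding UNIV_5 by (simp add: ac_simps)

lemma forall_5: "(\<forall>i::5. P i) \<longleftrightarrow> P 1 \<and> P 2 \<and> P 3 \<and> P 4 \<and> P 5"
proof -
  have "(\<forall>i::5. P i) \<longleftrightarrow> (\<forall>i\<in>{1, 2, 3, 4, 5}. P i)"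
    unfolding UNIV_5[symmetric] by simp
  then show ?thesis by simp
qed

lemma vector_5 [simp]:
  fixes s t u v w :: "'a::zero"
  shows "(vector [s, t, u, v, w] :: 'a^5) $ 1 = s"
    and "(vector [s, t, u, v, w] :: 'a^5) $ 2 = t"
    and "(vector [s, t, u, v, w] :: 'a^5) $ 3 = u"
    and "(vector [s, t, u, v, w] :: 'a^5) $ 4 = v"
    and "(vector [s, t, u, v, w] :: 'a^5) $ 5 = w"
  unfolding vector_def by simp_all

lemma invertible_thomae_matrix: "invertible thomae_matrix"
proof -
  define B :: "complex^5^5" where "B = vector
     [vector [ 1/3, -2/3, -2/3,  1/3,  1/3],
      vector [-2/3,  1/3, -2/3,  1/3,  1/3],
      vector [-2/3, -2/3,  1/3,  1/3,  1/3],
      vector [ 1/3,  1/3,  1/3,  1/3, -2/3],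
      vector [ 1/3,  1/3,  1/3, -2/3,  1/3]]"
  have "B ** thomae_matrix = mat 1"
    by (simp add: vec_eq_iff forall_5 sum_5 matrix_matrix_mult_def mat_def B_def thomae_matrix_def)
  then show ?thesis
    by (meson invertible_left_inverse)
qed

definition thomae_group :: "(complex^5 \<Rightarrow> complex^5) set" where
  "thomae_group =
     {\<lambda>p. (\<chi> i. (p v* matrix_inv thomae_matrix) $ \<sigma> i) v* thomae_matrix | \<sigma> :: 5 \<Rightarrow> 5. bij \<sigma>}"

definition thomae_orbit :: "(complex^5) set \<Rightarrow> (complex^5) set set" where
  "thomae_orbit V = {T ` V | T. T \<in> thomae_group}"

definition slater_orbit :: "(complex^5) set set" where
  "slater_orbit = thomae_orbit
     {p. let a = p $ 1; b = p $ 2; c = p $ 3; d = p $ 4; e = p $ 5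
         in a * b + b * c + c * a = (d - 1) * (e - 1) \<and> d + e - a - b - c = 2}"

definition dixon_watson_whipple_orbit :: "(complex^5) set set" where
  "dixon_watson_whipple_orbit = thomae_orbit
     {p. let a = p $ 1; b = p $ 2; c = p $ 3; d = p $ 4; e = p $ 5
         in d = 1 + a - b \<and> e = 1 + a - c}"

definition pfaff_saalschuetz_orbit :: "int \<Rightarrow> (complex^5) set set" where
  "pfaff_saalschuetz_orbit n = thomae_orbit
     {p. let a = p $ 1; b = p $ 2; c = p $ 3; d = p $ 4; e = p $ 5
         in a = - of_int n \<and> d + e - a - b - c = 1}"

end

theory Submission
  imports Defs "HOL-Library.Function_Algebras" "HOL-Computational_Algebra.Polynomial"
begin

text \<open>A chain of irreducible closed sets comes with polynomials separating consecutive members, and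
  these are algebraically independent on the largest one. Since the monomials in \<open>m > k\<close>
  polynomials in \<open>k\<close> variables outgrow the available monomials, a set parametrized polynomially by
  \<open>\<complex>\<^sup>k\<close> has dimension at most \<open>k\<close>, and a proper closed subset of it has smaller dimension.

  In (i) the two varieties themselves meet in the plane \<open>a = 2 (b + c)\<close>, \<open>d = 1 + a - b\<close>,
  \<open>e = 1 + a - c\<close>. For (ii) and (iii) pass to the coordinates \<open>(x,y,z;u,v)\<close>: the Pfaff--Saalschuetz
  plane is \<open>x + y + z = 1\<close>, \<open>x + u + v = -n\<close>, the Dixon--Watson--Whipple plane is
  \<open>y + u = z + v = 1/3\<close>, and the Slater variety lies in the hyperplane \<open>x + y + z = 2\<close>. After any
  permutation of the coordinates of one of them, the intersection is empty, a line, or a curve given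
  by a nonzero polynomial on a plane.\<close>

section \<open>Polynomial functions\<close>

definition polynomial_map :: "(complex^'k \<Rightarrow> complex^'n) \<Rightarrow> bool" where
  "polynomial_map \<phi> \<longleftrightarrow> (\<forall>i. polynomial_fun (\<lambda>p. \<phi> p $ i))"

lemma polynomial_fun_uminus: "polynomial_fun f \<Longrightarrow> polynomial_fun (\<lambda>p. - f p)"
  using polynomial_fun.mult[OF polynomial_fun.const[of "-1"], of f] by simp

lemma polynomial_fun_diff:
  "polynomial_fun f \<Longrightarrow> polynomial_fun g \<Longrightarrow> polynomial_fun (\<lambda>p. f p - g p)"
  using polynomial_fun.add[OF _ polynomial_fun_uminus, of f g] by simp

lemma polynomial_fun_power: "polynomial_fun f \<Longrightarrow> polynomial_fun (\<lambda>p. f p ^ k)"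
  by (induction k) (auto intro: polynomial_fun.intros)

lemma polynomial_fun_sum:
  "finite A \<Longrightarrow> (\<And>i. i \<in> A \<Longrightarrow> polynomial_fun (f i)) \<Longrightarrow> polynomial_fun (\<lambda>p. \<Sum>i\<in>A. f i p)"
  by (induction A rule: finite_induct) (auto intro: polynomial_fun.intros)

lemmas polynomial_fun_intros =
  polynomial_fun.intros polynomial_fun_uminus polynomial_fun_diff polynomial_fun_power
  polynomial_fun_sum

lemma polynomial_fun_compose:
  assumes "polynomial_fun f" "polynomial_map \<phi>"
  shows "polynomial_fun (\<lambda>p. f (\<phi> p))"
  using assms by (induction) (auto intro: polynomial_fun.intros simp: polynomial_map_def)

lemma polynomial_fun_on_line:
  assumes "polynomial_fun f"
  shows "\<exists>P. \<forall>t. f (p + t *s v) = poly P t"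
  using assms
proof induction
  case (const k)
  show ?case by (intro exI[of _ "[:k:]"]) simp
next
  case (coord i)
  show ?case by (intro exI[of _ "[:p $ i, v $ i:]"]) simp
next
  case (add f g)
  then show ?case by (metis poly_add)
next
  case (mult f g)
  then show ?case by (metis poly_mult)
qed

text \<open>On the line through a nonzero of \<open>f\<close> and a nonzero of \<open>g\<close>,
  both restrict to nonzero univariate polynomials, whose product cannot vanish at every
  \<open>t\<close>.\<close>

lemma polynomial_fun_mult_eq_0:
  assumes f: "polynomial_fun f" and g: "polynomial_fun g" and fg: "\<And>p. f p * g p = 0"
  shows "(\<forall>p. f p = 0) \<or> (\<forall>p. g p = 0)"
proof (rule ccontr)
  assume "\<not> ?thesis"
  then obtain p q where pq: "f p \<noteq> 0" "g q \<noteq> 0" by blast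
  obtain P where P: "\<And>t. f (p + t *s (q - p)) = poly P t"
    using polynomial_fun_on_line[OF f] by metis
  obtain Q where Q: "\<And>t. g (p + t *s (q - p)) = poly Q t"
    using polynomial_fun_on_line[OF g] by metis
  have "P \<noteq> 0" using P[of 0] pq by auto
  moreover have "Q \<noteq> 0" using Q[of 1] pq by auto
  moreover have "poly (P * Q) t = 0" for t
    using fg[of "p + t *s (q - p)"] unfolding P Q by simp
  ultimately show False
    by (metis mult_eq_0_iff poly_all_0_iff_0)
qed


section \<open>Irreducible sets\<close>

text \<open>The algebraic form of irreducibility, without closedness: the ideal of \<open>X\<close> is prime.\<close>

definition prime_set :: "(complex^'n) set \<Rightarrow> bool" where
  "prime_set X \<longleftrightarrow> X \<noteq> {} \<and>
     (\<forall>f g. polynomial_fun f \<longrightarrow> polynomial_fun g \<longrightarrow> (\<forall>p\<in>X. f p * g p = 0) \<longrightarrow>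
        (\<forall>p\<in>X. f p = 0) \<or> (\<forall>p\<in>X. g p = 0))"

lemma zariski_closed_zeros: "polynomial_fun f \<Longrightarrow> zariski_closed {p. f p = 0}"
  unfolding zariski_closed_def by (intro exI[of _ "{f}"]) auto

lemma zariski_closed_Int:
  assumes "zariski_closed X" "zariski_closed Y"
  shows "zariski_closed (X \<inter> Y)"
proof -
  obtain F G where "\<forall>f\<in>F \<union> G. polynomial_fun f" "X = {p. \<forall>f\<in>F. f p = 0}" "Y = {p. \<forall>f\<in>G. f p = 0}"
    using assms unfolding zariski_closed_def by blast
  then show ?thesis
    unfolding zariski_closed_def by (intro exI[of _ "F \<union> G"]) auto
qed

lemma zariski_closed_separate:
  assumes "zariski_closed X" "\<not> Y \<subseteq> X"
  shows "\<exists>f. polynomial_fun f \<and> (\<forall>p\<in>X. f p = 0) \<and> (\<exists>p\<in>Y. f p \<noteq> 0)"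
  using assms unfolding zariski_closed_def by blast

text \<open>If a product vanishes on \<open>X\<close>, the zeros of its factors cover
  \<open>X\<close> by two closed pieces. Conversely, functions separating \<open>X\<close> from two
  closed pieces that cover it have a product vanishing on \<open>X\<close>.\<close>

lemma irreducible_variety_iff_prime_set:
  "irreducible_variety X \<longleftrightarrow> zariski_closed X \<and> prime_set X"
proof
  assume X: "irreducible_variety X"
  have "(\<forall>p\<in>X. f p = 0) \<or> (\<forall>p\<in>X. g p = 0)"
    if fg: "polynomial_fun f" "polynomial_fun g" "\<forall>p\<in>X. f p * g p = 0" for f g
  proof -
    have "X = (X \<inter> {p. f p = 0}) \<union> (X \<inter> {p. g p = 0})" using fg by auto
    moreover have "zariski_closed (X \<inter> {p. f p = 0})" "zariski_closed (X \<inter> {p. g p = 0})"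
      using X fg by (auto simp: irreducible_variety_def intro: zariski_closed_Int zariski_closed_zeros)
    ultimately have "X = X \<inter> {p. f p = 0} \<or> X = X \<inter> {p. g p = 0}"
      using X unfolding irreducible_variety_def by blast
    then show ?thesis by blast
  qed
  then show "zariski_closed X \<and> prime_set X"
    using X unfolding prime_set_def irreducible_variety_def by blast
next
  assume X: "zariski_closed X \<and> prime_set X"
  have "X = Y \<or> X = Z" if YZ: "zariski_closed Y" "zariski_closed Z" "X = Y \<union> Z" for Y Z
  proof (rule ccontr)
    assume "\<not> ?thesis"
    then have "\<not> X \<subseteq> Y" "\<not> X \<subseteq> Z" using YZ by auto
    then obtain f g where f: "polynomial_fun f" "\<forall>p\<in>Y. f p = 0" "\<exists>p\<in>X. f p \<noteq> 0"
      and g: "polynomial_fun g" "\<forall>p\<in>Z. g p = 0" "\<exists>p\<in>X. g p \<noteq> 0"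
      using YZ zariski_closed_separate by metis
    have "\<forall>p\<in>X. f p * g p = 0" using f g YZ by auto
    then show False using X f g unfolding prime_set_def by blast
  qed
  then show "irreducible_variety X"
    using X unfolding irreducible_variety_def prime_set_def by blast
qed

lemma prime_set_image:
  assumes "prime_set X" "polynomial_map \<phi>"
  shows "prime_set (\<phi> ` X)"
  unfolding prime_set_def
proof (intro conjI allI impI)
  show "\<phi> ` X \<noteq> {}" using assms by (auto simp: prime_set_def)
  fix f g :: "complex^'b \<Rightarrow> complex"
  assume fg: "polynomial_fun f" "polynomial_fun g" "\<forall>p\<in>\<phi> ` X. f p * g p = 0"
  have "polynomial_fun (\<lambda>p. f (\<phi> p))" "polynomial_fun (\<lambda>p. g (\<phi> p))"
    using fg assms polynomial_fun_compose by blast+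
  moreover have "\<forall>p\<in>X. f (\<phi> p) * g (\<phi> p) = 0" using fg by auto
  ultimately show "(\<forall>p\<in>\<phi> ` X. f p = 0) \<or> (\<forall>p\<in>\<phi> ` X. g p = 0)"
    using assms(1) unfolding prime_set_def by (smt (verit) imageE)
qed

lemma prime_set_range: "polynomial_map \<phi> \<Longrightarrow> prime_set (range \<phi>)"
  by (rule prime_set_image) (use polynomial_fun_mult_eq_0 in \<open>auto simp: prime_set_def\<close>)

lemma irreducible_variety_range:
  "polynomial_map \<phi> \<Longrightarrow> zariski_closed (range \<phi>) \<Longrightarrow> irreducible_variety (range \<phi>)"
  by (simp add: irreducible_variety_iff_prime_set prime_set_range)

text \<open>The fixed points are cut out by the polynomials \<open>\<phi> p $ i - p $ i\<close>, and
  idempotence makes them the range of \<open>\<phi>\<close>, which is prime.\<close>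

lemma irreducible_variety_retract:
  fixes \<phi> :: "complex^'n \<Rightarrow> complex^'n"
  assumes \<phi>: "polynomial_map \<phi>" and idem: "\<And>p. \<phi> (\<phi> p) = \<phi> p"
  shows "irreducible_variety {p. \<phi> p = p}"
proof -
  have range: "{p. \<phi> p = p} = range \<phi>" using idem by (auto; metis rangeI)
  have "zariski_closed {p. \<phi> p = p}"
    unfolding zariski_closed_def
    using \<phi> by (intro exI[of _ "range (\<lambda>i p. \<phi> p $ i - p $ i)"])
      (auto simp: polynomial_map_def vec_eq_iff intro!: polynomial_fun_intros)
  then show ?thesis
    using \<phi> by (simp add: range irreducible_variety_range)
qed


section \<open>Polynomial relations between polynomial functions\<close>

interpretation fun_vs: vector_space "\<lambda>(c::complex) (f::'a \<Rightarrow> complex) x. c * f x"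
  by unfold_locales (auto simp: algebra_simps fun_eq_iff)

text \<open>Steinitz bound for families instead of sets: a repeated member gives a relation with
  coefficients 1 and -1; without repetition the members form a set of more than
  \<open>card B\<close> vectors in the span of \<open>B\<close>.\<close>

lemma fun_vs_dependent_family:
  fixes u :: "nat \<Rightarrow> 'a \<Rightarrow> complex"
  assumes B: "finite B" "card B < M" and u: "\<And>k. k < M \<Longrightarrow> u k \<in> fun_vs.span B"
  shows "\<exists>c. (\<exists>k<M. c k \<noteq> 0) \<and> (\<forall>x. (\<Sum>k<M. c k * u k x) = 0)"
proof (cases "inj_on u {..<M}")
  case False
  then obtain i j where ij: "i < M" "j < M" "i \<noteq> j" "u i = u j"
    by (auto simp: inj_on_def)
  define c where "c = (\<lambda>k. if k = i then 1 else if k = j then - 1 else 0 :: complex)"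
  have "(\<Sum>k<M. c k * u k x) = 0" for x
  proof -
    have "(\<Sum>k<M. c k * u k x) = (\<Sum>k\<in>{i, j}. c k * u k x)"
      using ij by (intro sum.mono_neutral_right) (auto simp: c_def)
    then show ?thesis using ij by (simp add: c_def)
  qed
  then show ?thesis using ij by (intro exI[of _ c]) (auto simp: c_def)
next
  case True
  have "fun_vs.dependent (u ` {..<M})"
  proof (rule ccontr)
    assume "\<not> fun_vs.dependent (u ` {..<M})"
    then have "card (u ` {..<M}) \<le> card B"
      using fun_vs.independent_span_bound[OF B(1)] u by blast
    then show False using B card_image[OF True] by simp
  qed
  then obtain a where a: "\<exists>f\<in>u ` {..<M}. a f \<noteq> 0" "(\<Sum>f\<in>u ` {..<M}. (\<lambda>x. a f * f x)) = 0"
    unfolding fun_vs.dependent_finite[OF finite_imageI[OF finite_lessThan]] by blast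
  have "(\<Sum>k<M. a (u k) * u k x) = 0" for x
  proof -
    have "(\<Sum>k<M. a (u k) * u k x) = (\<Sum>f\<in>u ` {..<M}. a f * f x)"
      by (simp add: sum.reindex[OF True])
    also have "\<dots> = (\<Sum>f\<in>u ` {..<M}. (\<lambda>x. a f * f x)) x"
      by (induction rule: infinite_finite_induct) auto
    finally show ?thesis by (simp add: a)
  qed
  then show ?thesis using a by (intro exI[of _ "\<lambda>k. a (u k)"]) auto
qed

section \<open>Monomials with bounded exponents\<close>

text \<open>Each exponent is bounded separately, not the total degree: this gives the simple count
  in \<open>card_monomials\<close>, and bounds add under multiplication.\<close>

definition monomials :: "nat \<Rightarrow> (complex^'n \<Rightarrow> complex) set" where
  "monomials K = (\<lambda>\<beta> p. \<Prod>i\<in>UNIV. p $ i ^ \<beta> i) ` {\<beta>. \<forall>i. \<beta> i \<le> K}"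

lemma exponents_PiE: "{\<beta>::'n \<Rightarrow> nat. \<forall>i. \<beta> i \<le> K} = PiE UNIV (\<lambda>_. {..K})"
  by auto

lemma finite_monomials: "finite (monomials K :: (complex^'n \<Rightarrow> complex) set)"
  unfolding monomials_def exponents_PiE by (intro finite_imageI finite_PiE) auto

lemma card_monomials: "card (monomials K :: (complex^'n \<Rightarrow> complex) set) \<le> (K + 1) ^ CARD('n)"
proof -
  have "card (monomials K :: (complex^'n \<Rightarrow> complex) set) \<le> card (PiE (UNIV :: 'n set) (\<lambda>_. {..K}))"
    unfolding monomials_def exponents_PiE by (intro card_image_le finite_PiE) auto
  then show ?thesis by (simp add: card_PiE)
qed

lemma monomials_mult:
  assumes "f \<in> monomials K" "g \<in> monomials L"
  shows "(\<lambda>p. f p * g p) \<in> monomials (K + L)"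
proof -
  obtain \<beta> \<gamma> where "\<And>i. \<beta> i \<le> K" "\<And>i. \<gamma> i \<le> L"
    "f = (\<lambda>p. \<Prod>i\<in>UNIV. p $ i ^ \<beta> i)" "g = (\<lambda>p. \<Prod>i\<in>UNIV. p $ i ^ \<gamma> i)"
    using assms unfolding monomials_def by auto
  then show ?thesis
    unfolding monomials_def
    by (intro image_eqI[of _ _ "\<lambda>i. \<beta> i + \<gamma> i"]) (auto simp: power_add prod.distrib add_mono)
qed

lemma span_monomials_mult:
  assumes f: "f \<in> fun_vs.span (monomials K)" and g: "g \<in> fun_vs.span (monomials L)"
  shows "(\<lambda>p. f p * g p) \<in> fun_vs.span (monomials (K + L))"
  using f
proof (induction rule: fun_vs.span_induct_alt)
  case base
  show ?case using fun_vs.span_zero by (simp add: zero_fun_def)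
next
  case (step c h f)
  have "(\<lambda>p. h p * g p) \<in> fun_vs.span (monomials (K + L))"
    using g
  proof (induction rule: fun_vs.span_induct_alt)
    case base
    show ?case using fun_vs.span_zero by (simp add: zero_fun_def)
  next
    case (step c' h' g')
    have "(\<lambda>p. c' * (h p * h' p)) + (\<lambda>p. h p * g' p) \<in> fun_vs.span (monomials (K + L))"
      using step monomials_mult[OF \<open>h \<in> monomials K\<close>, of h' L]
      by (intro fun_vs.span_add fun_vs.span_scale[OF fun_vs.span_base]) auto
    then show ?case by (simp add: plus_fun_def algebra_simps)
  qed
  then have "(\<lambda>p. c * (h p * g p)) + (\<lambda>p. f p * g p) \<in> fun_vs.span (monomials (K + L))"
    using step by (intro fun_vs.span_add fun_vs.span_scale) auto
  then show ?case by (simp add: plus_fun_def algebra_simps)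
qed

lemma span_monomials_mono:
  assumes "f \<in> fun_vs.span (monomials K)" "K \<le> L"
  shows "f \<in> fun_vs.span (monomials L)"
proof -
  have "monomials K \<subseteq> monomials L"
    using assms(2) unfolding monomials_def by (intro image_mono) (auto intro: order_trans)
  then show ?thesis using assms(1) fun_vs.span_mono by blast
qed

lemma one_in_span_monomials: "(\<lambda>p. 1) \<in> fun_vs.span (monomials K)"
  unfolding monomials_def
  by (intro fun_vs.span_base image_eqI[of _ _ "\<lambda>_. 0"]) auto

lemma polynomial_fun_in_span_monomials:
  assumes "polynomial_fun f"
  shows "\<exists>K. f \<in> fun_vs.span (monomials K)"
  using assms
proof induction
  case (const k)
  show ?case
    using fun_vs.span_scale[OF one_in_span_monomials, of k] by auto
next
  case (coord i)
  have "(\<lambda>p. p $ i) \<in> fun_vs.span (monomials 1)"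
    unfolding monomials_def
    by (intro fun_vs.span_base image_eqI[of _ _ "\<lambda>j. if j = i then 1 else 0"])
      (auto simp: if_distrib[of "\<lambda>k. _ ^ k"] prod.delta cong: if_cong)
  then show ?case by blast
next
  case (add f g)
  then obtain K L where "f \<in> fun_vs.span (monomials K)" "g \<in> fun_vs.span (monomials L)" by blast
  then have "f + g \<in> fun_vs.span (monomials (max K L))"
    by (intro fun_vs.span_add) (auto elim: span_monomials_mono)
  then show ?case by (auto simp: plus_fun_def)
next
  case (mult f g)
  then show ?case using span_monomials_mult by blast
qed

lemma span_monomials_power:
  assumes "f \<in> fun_vs.span (monomials K)"
  shows "(\<lambda>p. f p ^ k) \<in> fun_vs.span (monomials (k * K))"
  by (induction k) (use assms in \<open>auto intro: one_in_span_monomials span_monomials_mult\<close>)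

lemma span_monomials_prod:
  assumes "\<And>i. i < m \<Longrightarrow> f i \<in> fun_vs.span (monomials K)"
  shows "(\<lambda>p. \<Prod>i<m. f i p) \<in> fun_vs.span (monomials (m * K))"
  using assms
  by (induction m)
    (auto intro: one_in_span_monomials simp: mult.commute[of "prod _ _"] intro!: span_monomials_mult)

text \<open>The exponent vectors in \<open>{0..<N}\<^sup>m\<close> are encoded as the base-\<open>N\<close> digits of \<open>k < N ^ m\<close>.
  There are more of these than monomials available for the products, hence a linear relation.\<close>

lemma polynomial_funs_dependent:
  fixes f :: "nat \<Rightarrow> complex^'k \<Rightarrow> complex"
  assumes m: "CARD('k) < m" and f: "\<And>i. i < m \<Longrightarrow> polynomial_fun (f i)"
  shows "\<exists>N c. 0 < N \<and> (\<exists>k<N ^ m. c k \<noteq> 0) \<and>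
    (\<forall>p. (\<Sum>k<N ^ m. c k * (\<Prod>i<m. f i p ^ (k div N ^ i mod N))) = 0)"
proof -
  obtain d where d: "\<And>i. i < m \<Longrightarrow> f i \<in> fun_vs.span (monomials (d i))"
    using polynomial_fun_in_span_monomials[OF f] by metis
  define D where "D = (\<Sum>i<m. d i)"
  have D: "f i \<in> fun_vs.span (monomials D)" if "i < m" for i
    unfolding D_def using d[OF that] that
    by (elim span_monomials_mono) (auto intro: member_le_sum)
  define n where "n = CARD('k)"
  \<comment> \<open>Chosen so that \<open>(N * (m * D + 1)) ^ n = N ^ n * (N - 1)\<close>, a bound
    for the number of monomials, is less than \<open>N ^ (n + 1) \<le> N ^ m\<close>, the number of
    products.\<close>
  define N where "N = (m * D + 1) ^ n + 1"
  define u where "u = (\<lambda>k p. \<Prod>i<m. f i p ^ (k div N ^ i mod N))"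
  have "u k \<in> fun_vs.span (monomials (m * (N * D)))" for k
    unfolding u_def
  proof (rule span_monomials_prod)
    fix i assume "i < m"
    have "k div N ^ i mod N \<le> N" by (simp add: N_def)
    then show "(\<lambda>p. f i p ^ (k div N ^ i mod N)) \<in> fun_vs.span (monomials (N * D))"
      by (intro span_monomials_mono[OF span_monomials_power[OF D[OF \<open>i < m\<close>]]]) auto
  qed
  moreover have "card (monomials (m * (N * D)) :: (complex^'k \<Rightarrow> complex) set) < N ^ m"
  proof -
    have "card (monomials (m * (N * D)) :: (complex^'k \<Rightarrow> complex) set) \<le> (m * (N * D) + 1) ^ n"
      unfolding n_def by (rule card_monomials)
    also have "\<dots> \<le> (N * (m * D + 1)) ^ n"
      by (intro power_mono) (auto simp: N_def algebra_simps)
    also have "\<dots> = N ^ n * (m * D + 1) ^ n" by (rule power_mult_distrib)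
    also have "\<dots> < N ^ n * N" by (simp add: N_def)
    also have "\<dots> = N ^ Suc n" by simp
    also have "\<dots> \<le> N ^ m" using m by (intro power_increasing) (auto simp: N_def n_def)
    finally show ?thesis .
  qed
  ultimately obtain c where "\<exists>k<N ^ m. c k \<noteq> 0" "\<forall>p. (\<Sum>k<N ^ m. c k * u k p) = 0"
    using fun_vs_dependent_family[OF finite_monomials, of "m * (N * D)" "N ^ m" u] by blast
  then show ?thesis unfolding u_def by (intro exI[of _ N] exI[of _ c]) (auto simp: N_def)
qed


section \<open>Bounds for the Krull dimension\<close>

text \<open>Functions separating the members of a chain of irreducible sets are algebraically
  independent: after cancelling a power of the last function, restrict the relation to the last
  but one set of the chain.\<close>

lemma chain_independent:
  assumes "\<And>i. i \<le> m \<Longrightarrow> prime_set (C i)"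
    and "\<And>i. i < m \<Longrightarrow> C i \<subseteq> C (Suc i)"
    and "\<And>i. i < m \<Longrightarrow> polynomial_fun (f i)"
    and "\<And>i p. i < m \<Longrightarrow> p \<in> C i \<Longrightarrow> f i p = 0"
    and "\<And>i. i < m \<Longrightarrow> \<exists>p\<in>C (Suc i). f i p \<noteq> 0"
    and "0 < N" and "k < N ^ m" and "c k \<noteq> 0"
  shows "\<exists>p\<in>C m. (\<Sum>k<N ^ m. c k * (\<Prod>i<m. f i p ^ (k div N ^ i mod N))) \<noteq> 0"
  using assms
proof (induction m arbitrary: c k)
  case 0
  then show ?case by (auto simp: prime_set_def)
next
  case (Suc m)
  define M where "M = N ^ m"
  have "M > 0" using Suc.prems by (simp add: M_def)
  \<comment> \<open>Split \<open>k = j * M + r\<close> at its leading digit \<open>j\<close>, the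
    exponent of \<open>f m\<close>. Then \<open>g j\<close> is the coefficient of
    \<open>f m ^ j\<close>, a polynomial in the earlier functions.\<close>
  define g where "g = (\<lambda>j p. \<Sum>r<M. c (j * M + r) * (\<Prod>i<m. f i p ^ (r div N ^ i mod N)))"
  have digit: "(j * M + r) div N ^ i mod N = r div N ^ i mod N" if "i < m" for i j r
  proof -
    \<comment> \<open>As \<open>i < m\<close>, \<open>M\<close> is a multiple of
      \<open>N ^ (i + 1)\<close>, so adding \<open>j * M\<close> leaves digit \<open>i\<close>
      unchanged.\<close>
    have M: "M = N ^ Suc (m - Suc i) * N ^ i"
      unfolding M_def power_add[symmetric] using that by simp
    have "j * M + r = r + (j * N ^ (m - Suc i) * N) * N ^ i" by (simp add: M)
    then have "(j * M + r) div N ^ i = j * N ^ (m - Suc i) * N + r div N ^ i"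
      using Suc.prems(6) by (simp only: div_mult_self1 power_eq_0_iff) simp
    then show ?thesis by simp
  qed
  have digit': "(j * M + r) div N ^ m mod N = j" if "j < N" "r < M" for j r
    using that \<open>M > 0\<close> by (simp flip: M_def)
  have expand: "(\<Sum>k<N ^ Suc m. c k * (\<Prod>i<Suc m. f i p ^ (k div N ^ i mod N))) =
      (\<Sum>j<N. f m p ^ j * g j p)" for p
  proof -
    let ?t = "\<lambda>k. c k * (\<Prod>i<Suc m. f i p ^ (k div N ^ i mod N))"
    have "sum ?t {..<N ^ Suc m} = (\<Sum>j<N. sum ?t {j * M..<j * M + M})"
      by (simp add: sum.nat_group M_def)
    also have "\<dots> = (\<Sum>j<N. \<Sum>r<M. ?t (j * M + r))"
    proof (rule sum.cong)
      fix j
      show "sum ?t {j * M..<j * M + M} = (\<Sum>r<M. ?t (j * M + r))"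
        by (rule sum.reindex_bij_witness[of _ "\<lambda>r. j * M + r" "\<lambda>k. k - j * M"]) auto
    qed simp
    also have "\<dots> = (\<Sum>j<N. f m p ^ j * g j p)"
      unfolding g_def sum_distrib_left
    proof (intro sum.cong refl)
      fix j r assume "j \<in> {..<N}" "r \<in> {..<M}"
      then have "(j * M + r) div N ^ m mod N = j" by (simp add: digit')
      moreover have "(\<Prod>i<m. f i p ^ ((j * M + r) div N ^ i mod N)) =
          (\<Prod>i<m. f i p ^ (r div N ^ i mod N))"
        by (rule prod.cong) (simp_all only: lessThan_iff digit)
      ultimately show "?t (j * M + r) =
          f m p ^ j * (c (j * M + r) * (\<Prod>i<m. f i p ^ (r div N ^ i mod N)))"
        by (simp only: prod.lessThan_Suc mult_ac)
    qed
    finally show ?thesis .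
  qed
  have g_poly: "polynomial_fun (g j)" for j
  proof -
    have "polynomial_fun (\<lambda>p. \<Prod>i<l. f i p ^ (r div N ^ i mod N))" if "l \<le> m" for l r
      using that by (induction l) (auto intro!: polynomial_fun_intros Suc.prems)
    then show ?thesis unfolding g_def by (intro polynomial_fun_intros) auto
  qed
  define P where "P = (\<lambda>j. j < N \<and> (\<exists>r<M. c (j * M + r) \<noteq> 0))"
  have "P (k div M)"
    unfolding P_def
  proof (intro conjI exI[of _ "k mod M"])
    show "k div M < N"
      using Suc.prems(7) by (simp add: M_def less_mult_imp_div_less)
    show "c (k div M * M + k mod M) \<noteq> 0" using Suc.prems(8) by simp
  qed (use \<open>M > 0\<close> in auto)
  \<comment> \<open>The lowest power of \<open>f m\<close> with a nonzero coefficient block; the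
    nonzero \<open>c k\<close> guarantees that one exists.\<close>
  define j0 where "j0 = (LEAST j. P j)"
  have "P j0" using \<open>P (k div M)\<close> unfolding j0_def by (rule LeastI)
  then obtain r where r: "r < M" "c (j0 * M + r) \<noteq> 0" "j0 < N" unfolding P_def by auto
  have g0: "g j p = 0" if "j < j0" for j p
  proof -
    have "\<not> P j" using that unfolding j0_def by (rule not_less_Least)
    then show ?thesis using that r(3) by (simp add: g_def P_def)
  qed
  define h where "h = (\<lambda>p. \<Sum>j\<in>{j0..<N}. f m p ^ (j - j0) * g j p)"
  have factor: "(\<Sum>j<N. f m p ^ j * g j p) = f m p ^ j0 * h p" for p
  proof -
    have "(\<Sum>j<N. f m p ^ j * g j p) = (\<Sum>j\<in>{j0..<N}. f m p ^ j * g j p)"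
      by (rule sum.mono_neutral_right) (auto simp: g0)
    then show ?thesis
      by (simp add: h_def sum_distrib_left flip: mult.assoc power_add)
  qed
  obtain p where p: "p \<in> C m" "g j0 p \<noteq> 0"
    using Suc.IH[of r "\<lambda>r. c (j0 * M + r)"] Suc.prems r unfolding g_def M_def by force
  \<comment> \<open>\<open>f m\<close> vanishes on \<open>C m\<close>, so at \<open>p\<close> only
    the term without a factor \<open>f m\<close> survives.\<close>
  have "h p = g j0 p"
  proof -
    have "h p = (\<Sum>j\<in>{j0}. f m p ^ (j - j0) * g j p)"
      unfolding h_def using r Suc.prems(4)[of m p] p
      by (intro sum.mono_neutral_right) auto
    then show ?thesis by simp
  qed
  then have "\<exists>p\<in>C (Suc m). h p \<noteq> 0" using p Suc.prems(2) by (metis lessI subsetD)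
  moreover have "\<exists>p\<in>C (Suc m). f m p ^ j0 \<noteq> 0" using Suc.prems(5)[of m] by auto
  moreover have "polynomial_fun h"
    unfolding h_def using g_poly Suc.prems(3) by (intro polynomial_fun_intros) auto
  moreover have "polynomial_fun (\<lambda>p. f m p ^ j0)"
    using Suc.prems(3) by (intro polynomial_fun_intros) auto
  moreover have "prime_set (C (Suc m))" using Suc.prems(1) by simp
  \<comment> \<open>Neither factor vanishes identically on the prime set \<open>C (Suc m)\<close>,
    hence neither does the product.\<close>
  ultimately have "\<exists>p\<in>C (Suc m). f m p ^ j0 * h p \<noteq> 0"
    unfolding prime_set_def by blast
  then show ?case unfolding expand factor .
qed

text \<open>If \<open>m\<close> exceeded the number of parameters, the separating functions pulled
  back along \<open>\<phi>\<close> would satisfy a relation; it would hold on \<open>C m\<close>,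
  against \<open>chain_independent\<close>. The members are prime and separated rather than closed,
  so that a range can be the top of a chain.\<close>

lemma chain_length_le:
  fixes \<phi> :: "complex^'k \<Rightarrow> complex^'n"
  assumes prime: "\<And>i. i \<le> m \<Longrightarrow> prime_set (C i)"
    and sub: "\<And>i. i < m \<Longrightarrow> C i \<subseteq> C (Suc i)"
    and sep: "\<And>i. i < m \<Longrightarrow> \<exists>f. polynomial_fun f \<and> (\<forall>p\<in>C i. f p = 0) \<and> (\<exists>p\<in>C (Suc i). f p \<noteq> 0)"
    and \<phi>: "polynomial_map \<phi>" "C m \<subseteq> range \<phi>"
  shows "m \<le> CARD('k)"
proof (rule ccontr)
  assume m: "\<not> m \<le> CARD('k)"
  obtain f where f: "\<And>i. i < m \<Longrightarrow> polynomial_fun (f i)"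
    "\<And>i p. i < m \<Longrightarrow> p \<in> C i \<Longrightarrow> f i p = 0" "\<And>i. i < m \<Longrightarrow> \<exists>p\<in>C (Suc i). f i p \<noteq> 0"
    using sep by metis
  have "\<exists>N c. 0 < N \<and> (\<exists>k<N ^ m. c k \<noteq> 0) \<and>
      (\<forall>p. (\<Sum>k<N ^ m. c k * (\<Prod>i<m. f i (\<phi> p) ^ (k div N ^ i mod N))) = 0)"
    by (rule polynomial_funs_dependent) (use m in simp, rule polynomial_fun_compose[OF f(1) \<phi>(1)])
  then obtain N c k where N: "0 < N" "k < N ^ m" "c k \<noteq> 0"
    "\<And>p. (\<Sum>k<N ^ m. c k * (\<Prod>i<m. f i (\<phi> p) ^ (k div N ^ i mod N))) = 0"
    by blast
  have "\<exists>p\<in>C m. (\<Sum>k<N ^ m. c k * (\<Prod>i<m. f i p ^ (k div N ^ i mod N))) \<noteq> 0"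
    by (rule chain_independent) (use prime sub f N in auto)
  then show False using N(4) \<phi>(2) by auto
qed

lemma dim_variety_le:
  fixes \<phi> :: "complex^'k \<Rightarrow> complex^'n"
  assumes "polynomial_map \<phi>" "X \<subseteq> range \<phi>"
  shows "dim_variety X \<le> CARD('k)"
  unfolding dim_variety_def
proof (rule Sup_least, clarsimp)
  fix m and C :: "nat \<Rightarrow> (complex^'n) set"
  assume C: "\<forall>i\<le>m. irreducible_variety (C i) \<and> C i \<subseteq> X" "\<forall>i<m. C i \<subset> C (Suc i)"
  show "m \<le> CARD('k)"
  proof (rule chain_length_le[of m C \<phi>])
    show "C m \<subseteq> range \<phi>" using C assms by blast
    fix i assume "i < m"
    then have "zariski_closed (C i)" "\<not> C (Suc i) \<subseteq> C i"
      using C by (auto simp: irreducible_variety_iff_prime_set psubset_eq)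
    then show "\<exists>f. polynomial_fun f \<and> (\<forall>p\<in>C i. f p = 0) \<and> (\<exists>p\<in>C (Suc i). f p \<noteq> 0)"
      by (rule zariski_closed_separate)
  qed (use C assms in \<open>auto simp: irreducible_variety_iff_prime_set\<close>)
qed

text \<open>\<open>g\<close> separates \<open>X\<close> from the range of \<open>\<phi>\<close>, so
  every chain in \<open>X\<close> can be prolonged by that range, and the longer chain still has
  length at most \<open>CARD('k)\<close>. The range may fail to be closed, but it is prime.\<close>

lemma dim_variety_less:
  fixes \<phi> :: "complex^'k \<Rightarrow> complex^'n"
  assumes \<phi>: "polynomial_map \<phi>" "X \<subseteq> range \<phi>"
    and g: "polynomial_fun g" "\<And>p. p \<in> X \<Longrightarrow> g p = 0" "g (\<phi> t) \<noteq> 0"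
  shows "dim_variety X < CARD('k)"
proof -
  have "m \<le> CARD('k) - 1"
    if C: "\<forall>i\<le>m. irreducible_variety (C i) \<and> C i \<subseteq> X" "\<forall>i<m. C i \<subset> C (Suc i)"
    for m and C :: "nat \<Rightarrow> (complex^'n) set"
  proof -
    define C' where "C' = C(Suc m := range \<phi>)"
    have "\<exists>f. polynomial_fun f \<and> (\<forall>p\<in>C' i. f p = 0) \<and> (\<exists>p\<in>C' (Suc i). f p \<noteq> 0)"
      if "i < Suc m" for i
    proof (cases "i = m")
      case True
      then show ?thesis using C(1) g unfolding C'_def by (intro exI[of _ g]) auto
    next
      case False
      then have "i < m" using that by simp
      then have "zariski_closed (C i)" "C i \<subset> C (Suc i)"
        using C by (auto simp: irreducible_variety_iff_prime_set)
      then show ?thesis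
        using zariski_closed_separate[of "C i" "C (Suc i)"] False that by (simp add: C'_def)
    qed
    moreover have "C' i \<subseteq> C' (Suc i)" if "i < Suc m" for i
    proof (cases "i = m")
      case True
      then show ?thesis using C(1) \<phi>(2) by (auto simp: C'_def)
    next
      case False
      then have "C i \<subset> C (Suc i)" using C(2) that by simp
      then show ?thesis using False that by (auto simp: C'_def)
    qed
    moreover have "prime_set (C' i)" if "i \<le> Suc m" for i
      using C that prime_set_range[OF \<phi>(1)]
      by (cases "i = Suc m") (auto simp: C'_def irreducible_variety_iff_prime_set)
    ultimately have "Suc m \<le> CARD('k)"
      using \<phi>(1) by (intro chain_length_le[of "Suc m" C' \<phi>]) (auto simp: C'_def)
    then show ?thesis by simp
  qed
  then have "dim_variety X \<le> enat (CARD('k) - 1)"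
    unfolding dim_variety_def by (intro Sup_least) auto
  also have "\<dots> < enat (CARD('k))" by simp
  finally show ?thesis by (simp add: of_nat_eq_enat)
qed

section \<open>Lower bounds and polynomial embeddings\<close>

lemma dim_variety_ge:
  assumes "\<And>i. i \<le> m \<Longrightarrow> irreducible_variety (C i) \<and> C i \<subseteq> X" "\<And>i. i < m \<Longrightarrow> C i \<subset> C (Suc i)"
  shows "enat m \<le> dim_variety X"
  unfolding dim_variety_def using assms by (intro Sup_upper) auto

text \<open>Every chain in \<open>Y\<close> is prolonged by \<open>X\<close>.\<close>

lemma dim_variety_psubset:
  assumes X: "irreducible_variety X" and Y: "irreducible_variety Y" "Y \<subset> X"
  shows "eSuc (dim_variety Y) \<le> dim_variety X"
proof -
  let ?S = "{enat m | m. \<exists>C :: nat \<Rightarrow> (complex^'a) set.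
     (\<forall>i\<le>m. irreducible_variety (C i) \<and> C i \<subseteq> Y) \<and> (\<forall>i<m. C i \<subset> C (Suc i))}"
  \<comment> \<open>The chain consisting of \<open>Y\<close> alone has length 0; \<open>eSuc\<close>
    commutes with the supremum of a nonempty set only.\<close>
  have "?S \<noteq> {}"
    using Y by (auto intro!: exI[of _ 0] exI[of _ "\<lambda>_. Y"])
  moreover have "eSuc (enat m) \<le> dim_variety X"
    if C: "\<forall>i\<le>m. irreducible_variety (C i) \<and> C i \<subseteq> Y" "\<forall>i<m. C i \<subset> C (Suc i)" for m C
    unfolding eSuc_enat
  proof (rule dim_variety_ge)
    show "irreducible_variety ((C(Suc m := X)) i) \<and> (C(Suc m := X)) i \<subseteq> X" if "i \<le> Suc m" for i
      using that C(1) X Y(2) by (cases "i = Suc m") (auto dest: le_SucE)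
    show "(C(Suc m := X)) i \<subset> (C(Suc m := X)) (Suc i)" if "i < Suc m" for i
    proof (cases "i = m")
      case True
      then show ?thesis using C(1) Y(2) by auto
    next
      case False
      then have "C i \<subset> C (Suc i)" using C(2) that by simp
      then show ?thesis using False that by simp
    qed
  qed
  ultimately show ?thesis
    unfolding dim_variety_def[of Y] eSuc_Sup[OF \<open>?S \<noteq> {}\<close>] by (intro Sup_least) auto
qed

text \<open>The chain is the coordinate flag: \<open>e\<close> numbers the coordinates, and
  \<open>C m\<close> leaves the first \<open>m\<close> of them free, being the fixed-point set of a
  truncation.\<close>

lemma dim_variety_UNIV_ge: "enat (CARD('n)) \<le> dim_variety (UNIV :: (complex^'n) set)"
proof -
  obtain e :: "'n \<Rightarrow> nat" where e: "bij_betw e UNIV {0..<CARD('n)}"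
    using ex_bij_betw_finite_nat[OF finite_class.finite_UNIV] by blast
  define C :: "nat \<Rightarrow> (complex^'n) set" where "C = (\<lambda>m. {p. \<forall>i. m \<le> e i \<longrightarrow> p $ i = 0})"
  show ?thesis
  proof (rule dim_variety_ge)
    fix m
    define \<phi> :: "complex^'n \<Rightarrow> complex^'n" where "\<phi> = (\<lambda>p. \<chi> i. if m \<le> e i then 0 else p $ i)"
    have "polynomial_map \<phi>"
      unfolding polynomial_map_def
    proof
      show "polynomial_fun (\<lambda>p. \<phi> p $ i)" for i
        by (cases "m \<le> e i") (simp_all add: \<phi>_def polynomial_fun.const polynomial_fun.coord)
    qed
    then have "irreducible_variety {p. \<phi> p = p}"
      by (rule irreducible_variety_retract) (simp add: \<phi>_def vec_eq_iff)
    moreover have "{p. \<phi> p = p} = C m" by (auto simp: C_def \<phi>_def vec_eq_iff)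
    ultimately show "irreducible_variety (C m) \<and> C m \<subseteq> UNIV" by simp
  next
    fix m assume "m < CARD('n)"
    then have "m \<in> e ` UNIV" using bij_betw_imp_surj_on[OF e] by simp
    then obtain j where j: "e j = m" by blast
    have "axis j 1 \<in> C (Suc m)" "axis j 1 \<notin> C m"
      using j e by (auto simp: C_def axis_def bij_betw_def inj_on_def)
    moreover have "C m \<subseteq> C (Suc m)" by (auto simp: C_def)
    ultimately show "C m \<subset> C (Suc m)" by blast
  qed
qed

lemma irreducible_variety_UNIV: "irreducible_variety (UNIV :: (complex^'n) set)"
  using irreducible_variety_retract[of "\<lambda>p::complex^'n. p"]
  by (simp add: polynomial_map_def polynomial_fun.coord)

text \<open>The polynomial left inverse makes the image closed: it consists of the \<open>q\<close>
  with \<open>\<phi> (\<psi> q) = q\<close> and \<open>\<psi> q \<in> X\<close>, both polynomial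
  conditions.\<close>

lemma irreducible_variety_embedding:
  assumes X: "irreducible_variety X" and \<phi>: "polynomial_map \<phi>" "polynomial_map \<psi>"
    and inv: "\<And>p. \<psi> (\<phi> p) = p"
  shows "irreducible_variety (\<phi> ` X)"
proof -
  obtain F where F: "\<forall>f\<in>F. polynomial_fun f" "X = {p. \<forall>f\<in>F. f p = 0}"
    using X unfolding irreducible_variety_def zariski_closed_def by blast
  have "polynomial_map (\<lambda>q. \<phi> (\<psi> q))"
    using \<phi> polynomial_fun_compose by (auto simp: polynomial_map_def)
  then have "zariski_closed {q. \<phi> (\<psi> q) = q}"
    using irreducible_variety_retract[of "\<lambda>q. \<phi> (\<psi> q)"]
    by (simp add: inv irreducible_variety_iff_prime_set)
  moreover have "zariski_closed {q. \<forall>f\<in>(\<lambda>f q. f (\<psi> q)) ` F. f q = 0}"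
    unfolding zariski_closed_def using F(1) polynomial_fun_compose[OF _ \<phi>(2)]
    by (intro exI[of _ "(\<lambda>f q. f (\<psi> q)) ` F"]) auto
  moreover have "\<phi> ` X = {q. \<phi> (\<psi> q) = q} \<inter> {q. \<forall>f\<in>(\<lambda>f q. f (\<psi> q)) ` F. f q = 0}"
  proof -
    have "\<phi> ` X = {q. \<phi> (\<psi> q) = q} \<inter> {q. \<psi> q \<in> X}"
      using inv by (auto intro: rev_image_eqI)
    then show ?thesis by (simp add: F(2))
  qed
  ultimately have "zariski_closed (\<phi> ` X)" by (simp add: zariski_closed_Int)
  then show ?thesis
    using X \<phi>(1) by (simp add: irreducible_variety_iff_prime_set prime_set_image)
qed

text \<open>\<open>\<phi>\<close> carries chains to chains: images stay irreducible, and injectivity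
  keeps the inclusions strict.\<close>

lemma dim_variety_embedding:
  assumes \<phi>: "polynomial_map \<phi>" "polynomial_map \<psi>" and inv: "\<And>p. \<psi> (\<phi> p) = p"
  shows "dim_variety X \<le> dim_variety (\<phi> ` X)"
proof -
  have "enat m \<le> dim_variety (\<phi> ` X)"
    if C: "\<forall>i\<le>m. irreducible_variety (C i) \<and> C i \<subseteq> X" "\<forall>i<m. C i \<subset> C (Suc i)" for m C
  proof (rule dim_variety_ge)
    show "irreducible_variety (\<phi> ` C i) \<and> \<phi> ` C i \<subseteq> \<phi> ` X" if "i \<le> m" for i
      using C that irreducible_variety_embedding[OF _ \<phi> inv] by auto
    have "inj \<phi>" using inv by (metis injI)
    then show "\<phi> ` C i \<subset> \<phi> ` C (Suc i)" if "i < m" for i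
      using C that by (simp add: inj_image_subset_iff inj_image_eq_iff psubset_eq)
  qed
  then show ?thesis unfolding dim_variety_def[of X] by (intro Sup_least) auto
qed

text \<open>The parametrization bounds the dimension from above; the coordinate flag of the
  parameter space, carried over by \<open>\<phi>\<close>, bounds it from below.\<close>

lemma dim_variety_range_embedding:
  fixes \<phi> :: "complex^'k \<Rightarrow> complex^'n"
  assumes \<phi>: "polynomial_map \<phi>" "polynomial_map \<psi>" and inv: "\<And>p. \<psi> (\<phi> p) = p"
  shows "irreducible_variety (range \<phi>)" "dim_variety (range \<phi>) = enat (CARD('k))"
proof -
  show "irreducible_variety (range \<phi>)"
    by (rule irreducible_variety_embedding[OF irreducible_variety_UNIV \<phi> inv])
  show "dim_variety (range \<phi>) = enat (CARD('k))"
    using dim_variety_le[OF \<phi>(1) order_refl] dim_variety_UNIV_ge[where 'n='k]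
      dim_variety_embedding[OF \<phi> inv, of UNIV]
    by (simp add: of_nat_eq_enat)
qed


section \<open>Coordinates permuted by the Thomae group\<close>

definition sym_coords :: "complex^5 \<Rightarrow> complex^5" where
  "sym_coords p = p v* matrix_inv thomae_matrix"

lemma sym_coords_inverse: "sym_coords p v* thomae_matrix = p"
  and sym_coords_thomae: "sym_coords (w v* thomae_matrix) = w"
proof -
  have "thomae_matrix ** matrix_inv thomae_matrix = mat 1 \<and>
      matrix_inv thomae_matrix ** thomae_matrix = mat 1"
    using invertible_thomae_matrix unfolding invertible_def matrix_inv_def by (rule someI_ex)
  then show "sym_coords p v* thomae_matrix = p" "sym_coords (w v* thomae_matrix) = w"
    by (simp_all add: sym_coords_def vector_matrix_mul_assoc)
qed

lemma thomae_matrix_nth: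
  "(w v* thomae_matrix) $ 1 = w $ 1 + w $ 4 + w $ 5"
  "(w v* thomae_matrix) $ 2 = w $ 2 + w $ 4 + w $ 5"
  "(w v* thomae_matrix) $ 3 = w $ 3 + w $ 4 + w $ 5"
  "(w v* thomae_matrix) $ 4 = w $ 1 + w $ 2 + w $ 3 + 2 * w $ 4 + w $ 5"
  "(w v* thomae_matrix) $ 5 = w $ 1 + w $ 2 + w $ 3 + w $ 4 + 2 * w $ 5"
  by (simp_all add: vector_matrix_mult_def thomae_matrix_def sum_5)

lemma polynomial_map_vector_matrix_mult: "polynomial_map (\<lambda>p. p v* M)"
  unfolding polynomial_map_def vector_matrix_mult_def
  by (auto intro!: polynomial_fun_intros)

lemma polynomial_map_comp:
  "polynomial_map \<phi> \<Longrightarrow> polynomial_map \<psi> \<Longrightarrow> polynomial_map (\<lambda>p. \<phi> (\<psi> p))"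
  unfolding polynomial_map_def[of \<phi>] polynomial_map_def[of "\<lambda>p. \<phi> (\<psi> p)"]
  by (auto intro: polynomial_fun_compose)

definition permute_coords :: "(5 \<Rightarrow> 5) \<Rightarrow> complex^5 \<Rightarrow> complex^5" where
  "permute_coords \<sigma> p = (\<chi> i. sym_coords p $ \<sigma> i) v* thomae_matrix"

lemma sym_coords_permute_coords: "sym_coords (permute_coords \<sigma> p) = (\<chi> i. sym_coords p $ \<sigma> i)"
  by (simp add: permute_coords_def sym_coords_thomae)

text \<open>The action is contravariant: entry \<open>i\<close> of the outer result is entry
  \<open>\<tau> i\<close> of the inner one, hence entry \<open>\<sigma> (\<tau> i)\<close> of the
  original.\<close>

lemma permute_coords_compose:
  "permute_coords \<tau> (permute_coords \<sigma> p) = permute_coords (\<lambda>i. \<sigma> (\<tau> i)) p"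
  by (simp add: permute_coords_def[of \<tau>] permute_coords_def[of "\<lambda>i. \<sigma> (\<tau> i)"]
      sym_coords_permute_coords)

lemma permute_coords_id: "permute_coords (\<lambda>i. i) p = p"
  by (simp add: permute_coords_def sym_coords_inverse)

lemma polynomial_map_permute_coords: "polynomial_map (permute_coords \<sigma>)"
proof -
  have "polynomial_map (\<lambda>p. \<chi> i. sym_coords p $ \<sigma> i)"
    using polynomial_map_vector_matrix_mult[of "matrix_inv thomae_matrix"]
    by (simp add: polynomial_map_def sym_coords_def)
  then show ?thesis
    unfolding permute_coords_def[abs_def]
    by (rule polynomial_map_comp[OF polynomial_map_vector_matrix_mult])
qed

lemma thomae_orbit_eq: "thomae_orbit V = {permute_coords \<sigma> ` V | \<sigma>. bij \<sigma>}"
  unfolding thomae_orbit_def thomae_group_def permute_coords_def[abs_def] sym_coords_def by blast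

lemma in_thomae_orbit_self: "V \<in> thomae_orbit V"
  unfolding thomae_orbit_eq
  using permute_coords_id bij_id[unfolded id_def]
  by (intro CollectI exI[of _ "\<lambda>i. i"]) auto

text \<open>The inverse permutation describes \<open>V'\<close> by the equations of \<open>V\<close>
  with renamed coordinates. For the dimension, a lower bound is what excluding improper
  intersections calls for.\<close>

lemma in_thomae_orbitD:
  assumes "V' \<in> thomae_orbit V"
  shows "\<exists>\<tau>. bij \<tau> \<and> (\<forall>p. p \<in> V' \<longleftrightarrow> permute_coords \<tau> p \<in> V)"
    and "dim_variety V \<le> dim_variety V'"
proof -
  obtain \<sigma> where \<sigma>: "bij \<sigma>" "V' = permute_coords \<sigma> ` V"
    using assms unfolding thomae_orbit_eq by blast
  have inv1: "permute_coords (inv \<sigma>) (permute_coords \<sigma> p) = p" for p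
    using \<sigma>(1) by (simp add: permute_coords_compose permute_coords_id bij_is_surj surj_f_inv_f)
  have inv2: "permute_coords \<sigma> (permute_coords (inv \<sigma>) p) = p" for p
    using \<sigma>(1) by (simp add: permute_coords_compose permute_coords_id bij_is_inj)
  have "\<forall>p. p \<in> V' \<longleftrightarrow> permute_coords (inv \<sigma>) p \<in> V"
    unfolding \<sigma>(2) using inv1 inv2 by (auto intro: rev_image_eqI)
  then show "\<exists>\<tau>. bij \<tau> \<and> (\<forall>p. p \<in> V' \<longleftrightarrow> permute_coords \<tau> p \<in> V)"
    using \<sigma>(1) bij_imp_bij_inv by blast
  show "dim_variety V \<le> dim_variety V'"
    unfolding \<sigma>(2)
    by (rule dim_variety_embedding[where \<psi> = "permute_coords (inv \<sigma>)"])
      (simp_all add: polynomial_map_permute_coords inv1)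
qed


section \<open>The three varieties\<close>

definition slater_variety :: "(complex^5) set" where
  "slater_variety = {p. p $ 1 * p $ 2 + p $ 2 * p $ 3 + p $ 3 * p $ 1 = (p $ 4 - 1) * (p $ 5 - 1) \<and>
     p $ 4 + p $ 5 - p $ 1 - p $ 2 - p $ 3 = 2}"

definition dixon_watson_whipple_plane :: "(complex^5) set" where
  "dixon_watson_whipple_plane = {p. p $ 4 = 1 + p $ 1 - p $ 2 \<and> p $ 5 = 1 + p $ 1 - p $ 3}"

definition pfaff_saalschuetz_plane :: "int \<Rightarrow> (complex^5) set" where
  "pfaff_saalschuetz_plane n =
     {p. p $ 1 = - of_int n \<and> p $ 4 + p $ 5 - p $ 1 - p $ 2 - p $ 3 = 1}"

lemma orbit_eqs:
  "slater_orbit = thomae_orbit slater_variety"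
  "dixon_watson_whipple_orbit = thomae_orbit dixon_watson_whipple_plane"
  "pfaff_saalschuetz_orbit n = thomae_orbit (pfaff_saalschuetz_plane n)"
  by (simp_all add: slater_orbit_def slater_variety_def dixon_watson_whipple_orbit_def
      dixon_watson_whipple_plane_def pfaff_saalschuetz_orbit_def pfaff_saalschuetz_plane_def Let_def)

lemma vector_4 [simp]:
  "(vector [x, y, z, w] :: 'a::zero^4) $ 1 = x"
  "(vector [x, y, z, w] :: 'a::zero^4) $ 2 = y"
  "(vector [x, y, z, w] :: 'a::zero^4) $ 3 = z"
  "(vector [x, y, z, w] :: 'a::zero^4) $ 4 = w"
  unfolding vector_def by simp_all

lemma polynomial_map_vector_2:
  "polynomial_fun f1 \<Longrightarrow> polynomial_fun f2 \<Longrightarrow> polynomial_map (\<lambda>p. vector [f1 p, f2 p] :: complex^2)"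
  by (simp add: polynomial_map_def forall_2)

lemma polynomial_map_vector_3:
  "polynomial_fun f1 \<Longrightarrow> polynomial_fun f2 \<Longrightarrow> polynomial_fun f3 \<Longrightarrow>
   polynomial_map (\<lambda>p. vector [f1 p, f2 p, f3 p] :: complex^3)"
  by (simp add: polynomial_map_def forall_3)

lemma polynomial_map_vector_5:
  "polynomial_fun f1 \<Longrightarrow> polynomial_fun f2 \<Longrightarrow> polynomial_fun f3 \<Longrightarrow> polynomial_fun f4 \<Longrightarrow>
   polynomial_fun f5 \<Longrightarrow> polynomial_map (\<lambda>p. vector [f1 p, f2 p, f3 p, f4 p, f5 p] :: complex^5)"
  by (simp add: polynomial_map_def forall_5)

lemmas polynomial_map_intros =
  polynomial_map_vector_2 polynomial_map_vector_3 polynomial_map_vector_5 polynomial_fun_intros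

section \<open>Irreducibility and dimension of the varieties\<close>

lemma dixon_watson_whipple_plane:
  "irreducible_variety dixon_watson_whipple_plane" "dim_variety dixon_watson_whipple_plane = 3"
proof -
  define \<phi> :: "complex^3 \<Rightarrow> complex^5" where
    "\<phi> = (\<lambda>t. vector [t $ 1, t $ 2, t $ 3, 1 + t $ 1 - t $ 2, 1 + t $ 1 - t $ 3])"
  define \<psi> :: "complex^5 \<Rightarrow> complex^3" where "\<psi> = (\<lambda>p. vector [p $ 1, p $ 2, p $ 3])"
  have "dixon_watson_whipple_plane = range \<phi>"
  proof (intro set_eqI iffI)
    fix p assume "p \<in> dixon_watson_whipple_plane"
    then have "p = \<phi> (\<psi> p)"
      by (simp add: dixon_watson_whipple_plane_def vec_eq_iff forall_5 \<phi>_def \<psi>_def)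
    then show "p \<in> range \<phi>" by blast
  qed (auto simp: dixon_watson_whipple_plane_def \<phi>_def)
  moreover have "polynomial_map \<phi>" "polynomial_map \<psi>"
    unfolding \<phi>_def \<psi>_def by (intro polynomial_map_intros)+
  moreover have "\<psi> (\<phi> t) = t" for t by (simp add: \<phi>_def \<psi>_def vec_eq_iff forall_3)
  ultimately show "irreducible_variety dixon_watson_whipple_plane"
    "dim_variety dixon_watson_whipple_plane = 3"
    using dim_variety_range_embedding[of \<phi> \<psi>] by (simp_all add: numeral_eq_enat)
qed

lemma dim_pfaff_saalschuetz_plane: "dim_variety (pfaff_saalschuetz_plane n) = 3"
proof -
  define \<phi> :: "complex^3 \<Rightarrow> complex^5" where
    "\<phi> = (\<lambda>t. vector [- of_int n, t $ 1, t $ 2, t $ 3, 1 - of_int n + t $ 1 + t $ 2 - t $ 3])"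
  define \<psi> :: "complex^5 \<Rightarrow> complex^3" where "\<psi> = (\<lambda>p. vector [p $ 2, p $ 3, p $ 4])"
  have "pfaff_saalschuetz_plane n = range \<phi>"
  proof (intro set_eqI iffI)
    fix p assume p: "p \<in> pfaff_saalschuetz_plane n"
    then have p1: "p $ 1 = - of_int n" by (simp add: pfaff_saalschuetz_plane_def)
    have "p $ 5 = (p $ 4 + p $ 5 - p $ 1 - p $ 2 - p $ 3) + p $ 1 + p $ 2 + p $ 3 - p $ 4" by simp
    also have "p $ 4 + p $ 5 - p $ 1 - p $ 2 - p $ 3 = 1"
      using p unfolding pfaff_saalschuetz_plane_def by blast
    finally have "p = \<phi> (\<psi> p)"
      by (simp add: vec_eq_iff forall_5 \<phi>_def \<psi>_def p1)
    then show "p \<in> range \<phi>" by blast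
  qed (auto simp: pfaff_saalschuetz_plane_def \<phi>_def)
  moreover have "polynomial_map \<phi>" "polynomial_map \<psi>"
    unfolding \<phi>_def \<psi>_def by (intro polynomial_map_intros)+
  moreover have "\<psi> (\<phi> t) = t" for t by (simp add: \<phi>_def \<psi>_def vec_eq_iff forall_3)
  ultimately show ?thesis
    using dim_variety_range_embedding[of \<phi> \<psi>] by (simp add: numeral_eq_enat)
qed

text \<open>On the hyperplane \<open>d + e - a - b - c = 2\<close> the quadric reads \<open>a b = (c - D) (D - a - b)\<close> with
  \<open>D = d - 1\<close>. Hence it is the cone of singular \<open>2 \<times> 2\<close> matrices, which are the products of a column
  and a row.\<close>

lemma slater_variety_iff:
  "p \<in> slater_variety \<longleftrightarrow> p $ 1 * p $ 2 = (p $ 3 - p $ 4 + 1) * (p $ 4 - 1 - p $ 1 - p $ 2) \<and>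
     p $ 5 = 2 + p $ 1 + p $ 2 + p $ 3 - p $ 4"
proof -
  have "p $ 4 + p $ 5 - p $ 1 - p $ 2 - p $ 3 = 2 \<longleftrightarrow> p $ 5 = 2 + p $ 1 + p $ 2 + p $ 3 - p $ 4"
    by (auto simp: algebra_simps)
  moreover have
    "p $ 1 * p $ 2 + p $ 2 * p $ 3 + p $ 3 * p $ 1 = (p $ 4 - 1) * (p $ 5 - 1) \<longleftrightarrow>
     p $ 1 * p $ 2 = (p $ 3 - p $ 4 + 1) * (p $ 4 - 1 - p $ 1 - p $ 2)"
    if "p $ 5 = 2 + p $ 1 + p $ 2 + p $ 3 - p $ 4"
    unfolding that by algebra
  ultimately show ?thesis unfolding slater_variety_def by blast
qed

text \<open>The column \<open>(s, v)\<close> times the row \<open>(t, u)\<close> runs over all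
  singular 2 x 2 matrices, so the variety is the range of a polynomial map; its equations show that
  this range is closed.\<close>

lemma irreducible_slater_variety: "irreducible_variety slater_variety"
proof -
  \<comment> \<open>The matrix entries are \<open>s * t = a\<close>,
    \<open>s * u = c - d + 1\<close>, \<open>t * v = d - 1 - a - b\<close> and
    \<open>u * v = b\<close>; these determine \<open>c\<close>, \<open>d\<close> and
    \<open>e\<close>.\<close>
  define \<phi> :: "complex^5 \<Rightarrow> complex^5" where
    "\<phi> = (\<lambda>q. let s = q $ 1; t = q $ 2; u = q $ 3; v = q $ 4 in
      vector [s * t, u * v, (s + v) * (t + u), 1 + t * v + s * t + u * v,
        1 + s * u + s * t + u * v])"
  have poly: "polynomial_map \<phi>"
    unfolding \<phi>_def Let_def by (intro polynomial_map_intros)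
  have "\<exists>q. p = \<phi> q" if "p \<in> slater_variety" for p
  proof -
    have p: "p $ 1 * p $ 2 = (p $ 3 - p $ 4 + 1) * (p $ 4 - 1 - p $ 1 - p $ 2)"
      "p $ 5 = 2 + p $ 1 + p $ 2 + p $ 3 - p $ 4"
      using that by (simp_all add: slater_variety_iff)
    have "\<exists>s t u v. s * t = x \<and> u * v = y \<and> s * u = z \<and> t * v = w"
      if "x * y = z * w" for x y z w :: complex
    proof -
      \<comment> \<open>The matrix has rows \<open>(x, z)\<close> and \<open>(w, y)\<close>. A
        nonzero first row is taken as the row vector with \<open>s = 1\<close>, and \<open>v\<close>
        is the ratio of the second row to it; for a zero first row, \<open>s = 0\<close> and the
        second row is used.\<close>
      consider "x \<noteq> 0" | "x = 0" "z \<noteq> 0" | "x = 0" "z = 0" by blast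
      then show ?thesis
      proof cases
        case 1
        then show ?thesis
          using that by (intro exI[of _ 1] exI[of _ x] exI[of _ z] exI[of _ "w / x"]) (auto simp: field_simps)
      next
        case 2
        then show ?thesis
          using that by (intro exI[of _ 1] exI[of _ 0] exI[of _ z] exI[of _ "y / z"]) auto
      next
        case 3
        then show ?thesis
          by (intro exI[of _ 0] exI[of _ w] exI[of _ y] exI[of _ 1]) auto
      qed
    qed
    then obtain s t u v where e: "s * t = p $ 1" "u * v = p $ 2" "s * u = p $ 3 - p $ 4 + 1"
      "t * v = p $ 4 - 1 - p $ 1 - p $ 2"
      using p(1) by metis
    have "c = (s + v) * (t + u) \<and> d = 1 + t * v + s * t + u * v \<and> e = 1 + s * u + s * t + u * v"
      if "s * t = a" "u * v = b" "s * u = c - d + 1" "t * v = d - 1 - a - b" "e = 2 + a + b + c - d"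
      for a b c d e :: complex
    proof -
      have "(s + v) * (t + u) = s * t + s * u + t * v + u * v" by (simp add: algebra_simps)
      then show ?thesis by (simp add: that)
    qed
    from this[OF e p(2)] have "p = \<phi> (vector [s, t, u, v, 0])"
      unfolding \<phi>_def Let_def vec_eq_iff forall_5 vector_5 e by simp
    then show ?thesis by blast
  qed
  moreover have "\<phi> q \<in> slater_variety" for q
    unfolding slater_variety_iff \<phi>_def Let_def vector_5 by algebra
  ultimately have "slater_variety = range \<phi>" by blast
  moreover have "zariski_closed slater_variety"
  proof -
    have eq: "slater_variety =
        {p. p $ 1 * p $ 2 + p $ 2 * p $ 3 + p $ 3 * p $ 1 - (p $ 4 - 1) * (p $ 5 - 1) = 0} \<inter>
        {p. p $ 4 + p $ 5 - p $ 1 - p $ 2 - p $ 3 - 2 = 0}"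
      by (auto simp: slater_variety_def)
    show ?thesis
      unfolding eq by (intro zariski_closed_Int zariski_closed_zeros polynomial_fun_intros)
  qed
  ultimately show ?thesis using irreducible_variety_range[OF poly] by simp
qed

text \<open>From above, the quadric is a proper closed subset of a hyperplane; from below, it
  properly contains a plane.\<close>

lemma dim_slater_variety: "dim_variety slater_variety = 3"
proof (rule antisym)
  define \<phi> :: "complex^4 \<Rightarrow> complex^5" where
    "\<phi> = (\<lambda>t. vector [t $ 1, t $ 2, t $ 3, t $ 4, 2 + t $ 1 + t $ 2 + t $ 3 - t $ 4])"
  have "dim_variety slater_variety < CARD(4)"
  proof (rule dim_variety_less)
    show "polynomial_map \<phi>" unfolding \<phi>_def by (intro polynomial_map_intros)
    show "slater_variety \<subseteq> range \<phi>"
    proof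
      fix p assume "p \<in> slater_variety"
      then have "p = \<phi> (vector [p $ 1, p $ 2, p $ 3, p $ 4])"
        by (simp add: slater_variety_iff \<phi>_def vec_eq_iff forall_5)
      then show "p \<in> range \<phi>" by blast
    qed
    let ?g = "\<lambda>p::complex^5. p $ 1 * p $ 2 - (p $ 3 - p $ 4 + 1) * (p $ 4 - 1 - p $ 1 - p $ 2)"
    show "polynomial_fun ?g" by (intro polynomial_fun_intros)
    \<comment> \<open>At this point \<open>c - d + 1 = 0\<close> while
      \<open>a * b = 1\<close>.\<close>
    show "?g (\<phi> (vector [1, 1, 0, 1])) \<noteq> 0" by (simp add: \<phi>_def)
  qed (simp add: slater_variety_iff)
  then show "dim_variety slater_variety \<le> 3"
    by (cases "dim_variety slater_variety") (auto simp: numeral_eq_enat)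
next
  \<comment> \<open>The plane \<open>a = 0\<close>, \<open>d = 1 + c\<close>,
    \<open>e = 1 + b\<close>, on which the first row of the matrix is zero.\<close>
  define \<phi> :: "complex^2 \<Rightarrow> complex^5" where
    "\<phi> = (\<lambda>t. vector [0, t $ 1, t $ 2, 1 + t $ 2, 1 + t $ 1])"
  define \<psi> :: "complex^5 \<Rightarrow> complex^2" where "\<psi> = (\<lambda>p. vector [p $ 2, p $ 3])"
  have "polynomial_map \<phi>" "polynomial_map \<psi>"
    unfolding \<phi>_def \<psi>_def by (intro polynomial_map_intros)+
  moreover have "\<psi> (\<phi> t) = t" for t by (simp add: \<phi>_def \<psi>_def vec_eq_iff forall_2)
  ultimately have "irreducible_variety (range \<phi>)" "dim_variety (range \<phi>) = 2"
    using dim_variety_range_embedding[of \<phi> \<psi>] by (simp_all add: numeral_eq_enat)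
  moreover have "range \<phi> \<subset> slater_variety"
  proof -
    have "vector [1, 0, 0, 1, 2] \<in> slater_variety - range \<phi>"
      by (auto simp: slater_variety_iff \<phi>_def vec_eq_iff forall_5)
    moreover have "range \<phi> \<subseteq> slater_variety" by (auto simp: slater_variety_iff \<phi>_def)
    ultimately show ?thesis by blast
  qed
  ultimately have "eSuc 2 \<le> dim_variety slater_variety"
    using dim_variety_psubset[OF irreducible_slater_variety] by metis
  then show "3 \<le> dim_variety slater_variety" by (simp add: eSuc_numeral)
qed

section \<open>The improper intersection\<close>

lemma slater_dixon_intersect_improperly:
  "intersect_improperly slater_variety dixon_watson_whipple_plane"
proof -
  \<comment> \<open>On the Dixon--Watson--Whipple plane the linear Slater equation becomes
    \<open>a = 2 * (b + c)\<close>, and then both sides of the quadratic one equal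
    \<open>(b + 2 * c) * (2 * b + c)\<close>. The parameters are \<open>b\<close> and
    \<open>c\<close>.\<close>
  define \<phi> :: "complex^2 \<Rightarrow> complex^5" where
    "\<phi> = (\<lambda>t. vector [2 * (t $ 1 + t $ 2), t $ 1, t $ 2, 1 + t $ 1 + 2 * t $ 2, 1 + 2 * t $ 1 + t $ 2])"
  define \<psi> :: "complex^5 \<Rightarrow> complex^2" where "\<psi> = (\<lambda>p. vector [p $ 2, p $ 3])"
  have "polynomial_map \<phi>" "polynomial_map \<psi>"
    unfolding \<phi>_def \<psi>_def by (intro polynomial_map_intros)+
  moreover have "\<psi> (\<phi> t) = t" for t by (simp add: \<phi>_def \<psi>_def vec_eq_iff forall_2)
  ultimately have \<phi>: "irreducible_variety (range \<phi>)" "dim_variety (range \<phi>) = 2"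
    using dim_variety_range_embedding[of \<phi> \<psi>] by (simp_all add: numeral_eq_enat)
  have "slater_variety \<inter> dixon_watson_whipple_plane = range \<phi>"
  proof (intro set_eqI iffI)
    fix p assume "p \<in> slater_variety \<inter> dixon_watson_whipple_plane"
    then have p: "p $ 4 = 1 + p $ 1 - p $ 2" "p $ 5 = 1 + p $ 1 - p $ 3"
      "p $ 5 = 2 + p $ 1 + p $ 2 + p $ 3 - p $ 4"
      by (auto simp only: slater_variety_iff dixon_watson_whipple_plane_def mem_Collect_eq Int_iff)
    have "p $ 1 = 2 * (p $ 2 + p $ 3)" using p by algebra
    then have "p = \<phi> (\<psi> p)"
      using p(1,2) by (simp add: \<phi>_def \<psi>_def vec_eq_iff forall_5)
    then show "p \<in> range \<phi>" by blast
  qed (auto simp: slater_variety_iff dixon_watson_whipple_plane_def \<phi>_def algebra_simps)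
  \<comment> \<open>The intersection is irreducible, hence a component of itself, and
    \<open>3 + 3 < 2 + 5\<close>.\<close>
  then show ?thesis
    unfolding intersect_improperly_def irreducible_component_def
    using \<phi> irreducible_slater_variety dixon_watson_whipple_plane dim_slater_variety
    by (auto intro!: exI[of _ "range \<phi>"])
qed


section \<open>Intersections with the Pfaff--Saalschuetz planes\<close>

lemma dim_variety_affine_line:
  fixes W :: "(complex^'n) set"
  assumes "\<And>i. \<exists>\<alpha> \<beta>. \<forall>w\<in>W. w $ i = \<alpha> + \<beta> * w $ j"
  shows "dim_variety W < 2"
proof -
  obtain \<alpha> \<beta> where ab: "\<And>i. \<forall>w\<in>W. w $ i = \<alpha> i + \<beta> i * w $ j"
    using assms by metis
  define \<phi> :: "complex^1 \<Rightarrow> complex^'n" where "\<phi> = (\<lambda>t. \<chi> i. \<alpha> i + \<beta> i * t $ 1)"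
  have "polynomial_map \<phi>"
    unfolding polynomial_map_def \<phi>_def by (simp add: polynomial_fun.intros)
  moreover have "W \<subseteq> range \<phi>"
  proof
    fix w assume w: "w \<in> W"
    have "w = \<phi> (\<chi> i. w $ j)"
      unfolding vec_eq_iff
    proof
      show "w $ i = \<phi> (\<chi> i. w $ j) $ i" for i
        using bspec[OF ab w, of i] by (simp only: \<phi>_def vec_lambda_beta)
    qed
    then show "w \<in> range \<phi>" by blast
  qed
  ultimately have "dim_variety W \<le> CARD(1)" by (rule dim_variety_le)
  also have "enat CARD(1) < 2" by (simp add: numeral_eq_enat)
  finally show ?thesis by simp
qed

section \<open>Slater varieties against Pfaff--Saalschuetz planes\<close>

text \<open>The letters are indices of symmetric coordinates, not hypergeometric parameters:
  \<open>m\<close> is shared by the two equations, \<open>{a, b}\<close> and \<open>{e, f}\<close>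
  complete them. General constants allow the equations to be exchanged.\<close>

definition saalschuetz_eqs :: "(complex^5) set \<Rightarrow> 5 \<Rightarrow> 5 \<Rightarrow> 5 \<Rightarrow> 5 \<Rightarrow> 5 \<Rightarrow> complex \<Rightarrow> complex \<Rightarrow> bool"
  where "saalschuetz_eqs W m a b e f c c' \<longleftrightarrow>
    UNIV = {m, a, b, e, f} \<and> distinct [m, a, b, e, f] \<and>
    (\<forall>w\<in>W. w $ m + w $ a + w $ b = c \<and> w $ m + w $ e + w $ f = c')"

lemma saalschuetz_eqsD:
  assumes "saalschuetz_eqs W m a b e f c c'"
  shows "i = m \<or> i = a \<or> i = b \<or> i = e \<or> i = f" "distinct [m, a, b, e, f]"
    "w \<in> W \<Longrightarrow> w $ m + w $ a + w $ b = c" "w \<in> W \<Longrightarrow> w $ m + w $ e + w $ f = c'"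
  using assms unfolding saalschuetz_eqs_def by blast+

lemma saalschuetz_eqs_swap:
  assumes "saalschuetz_eqs W m a b e f c c'"
  shows "saalschuetz_eqs W m b a e f c c'" "saalschuetz_eqs W m a b f e c c'"
    "saalschuetz_eqs W m e f a b c' c"
  using assms unfolding saalschuetz_eqs_def
  by (simp_all add: insert_commute add.commute add.left_commute) blast+

text \<open>\<open>W\<close> lies in a surface parametrized by \<open>w $ m\<close> and
  \<open>w $ a\<close>. The equation \<open>g = 0\<close> holds on \<open>W\<close> but fails at the
  parameter point \<open>(x, y)\<close>, so the dimension drops below 2.\<close>

lemma saalschuetz_eqs_param:
  assumes S: "saalschuetz_eqs W m a b e f c c'"
    and lin: "\<And>w. w \<in> W \<Longrightarrow> w $ b = \<beta> (w $ m) (w $ a) \<and> w $ e = \<gamma> (w $ m) (w $ a) \<and> w $ f = \<delta> (w $ m) (w $ a)"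
    and poly: "polynomial_fun (\<lambda>t::complex^2. \<beta> (t $ 1) (t $ 2))" "polynomial_fun (\<lambda>t::complex^2. \<gamma> (t $ 1) (t $ 2))"
      "polynomial_fun (\<lambda>t::complex^2. \<delta> (t $ 1) (t $ 2))"
    and g: "\<And>w. w \<in> W \<Longrightarrow> g (w $ m) (w $ a) (w $ b) (w $ e) (w $ f) = 0"
    and g_poly: "polynomial_fun (\<lambda>w::complex^5. g (w $ m) (w $ a) (w $ b) (w $ e) (w $ f))"
    and nz: "g x y (\<beta> x y) (\<gamma> x y) (\<delta> x y) \<noteq> 0"
  shows "dim_variety W < 2"
proof -
  note names = saalschuetz_eqsD(1)[OF S]
  define \<phi> :: "complex^2 \<Rightarrow> complex^5" where
    "\<phi> = (\<lambda>t. \<chi> i. if i = m then t $ 1 else if i = a then t $ 2 else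
       if i = b then \<beta> (t $ 1) (t $ 2) else if i = e then \<gamma> (t $ 1) (t $ 2) else \<delta> (t $ 1) (t $ 2))"
  have \<phi>: "\<phi> t $ m = t $ 1" "\<phi> t $ a = t $ 2" "\<phi> t $ b = \<beta> (t $ 1) (t $ 2)"
    "\<phi> t $ e = \<gamma> (t $ 1) (t $ 2)" "\<phi> t $ f = \<delta> (t $ 1) (t $ 2)" for t
    using saalschuetz_eqsD(2)[OF S] by (auto simp: \<phi>_def)
  have "dim_variety W < CARD(2)"
  proof (rule dim_variety_less)
    show "polynomial_map \<phi>"
      unfolding polynomial_map_def
    proof
      show "polynomial_fun (\<lambda>t. \<phi> t $ i)" for i
        using names[of i] poly by (elim disjE) (simp_all add: \<phi> polynomial_fun.coord)
    qed
    show "W \<subseteq> range \<phi>"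
    proof
      fix w assume w: "w \<in> W"
      have "w = \<phi> (vector [w $ m, w $ a])"
        unfolding vec_eq_iff
      proof
        show "w $ i = \<phi> (vector [w $ m, w $ a]) $ i" for i
          using names[of i] lin[OF w] by (elim disjE) (simp_all only: \<phi> vector_2)
      qed
      then show "w \<in> range \<phi>" by blast
    qed
    show "g (\<phi> (vector [x, y]) $ m) (\<phi> (vector [x, y]) $ a) (\<phi> (vector [x, y]) $ b)
        (\<phi> (vector [x, y]) $ e) (\<phi> (vector [x, y]) $ f) \<noteq> 0"
      using nz by (simp add: \<phi>)
  qed (use g g_poly in auto)
  then show ?thesis by (simp add: numeral_eq_enat)
qed

text \<open>The equations of a Slater variety in the symmetric coordinates, where \<open>x\<close> and \<open>y\<close> are the two
  indices that play the role of \<open>u\<close> and \<open>v\<close>.\<close>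

definition slater_eqs :: "(complex^5) set \<Rightarrow> 5 \<Rightarrow> 5 \<Rightarrow> bool" where
  "slater_eqs W x y \<longleftrightarrow> x \<noteq> y \<and> (\<forall>w\<in>W. (\<Sum>i\<in>UNIV. w $ i) - w $ x - w $ y = 2 \<and>
     (1 + w $ x + w $ y)\<^sup>2 + 1 + 2 * ((w $ x)\<^sup>2 + (w $ y)\<^sup>2) = (\<Sum>i\<in>UNIV. (w $ i)\<^sup>2))"

lemma slater_eqs_sym: "slater_eqs W x y \<Longrightarrow> slater_eqs W y x"
  unfolding slater_eqs_def by (auto simp: algebra_simps)

lemma sum_names:
  assumes "saalschuetz_eqs W m a b e f c c'"
  shows "(\<Sum>i\<in>UNIV. h i) = h m + h a + h b + h e + (h f :: complex)"
proof -
  have "sum h UNIV = sum h {m, a, b, e, f}"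
    using assms unfolding saalschuetz_eqs_def by (intro arg_cong[of _ _ "sum h"]) blast
  then show ?thesis using saalschuetz_eqsD(2)[OF assms] by (simp add: ac_simps)
qed

lemma slater_eqsD:
  assumes "slater_eqs W x y" "saalschuetz_eqs W m a b e f c c'" "w \<in> W"
  shows "w $ m + w $ a + w $ b + w $ e + w $ f - w $ x - w $ y = 2"
    "(1 + w $ x + w $ y)\<^sup>2 + 1 + 2 * ((w $ x)\<^sup>2 + (w $ y)\<^sup>2) =
      (w $ m)\<^sup>2 + (w $ a)\<^sup>2 + (w $ b)\<^sup>2 + (w $ e)\<^sup>2 + (w $ f)\<^sup>2"
  using assms(1,3) unfolding slater_eqs_def sum_names[OF assms(2)] by blast+

text \<open>The equation of the Slater quadric restricts to a polynomial of degree one, as its quadratic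
  part cancels.\<close>

lemma dim_slater_saalschuetz_mixed:
  assumes S: "saalschuetz_eqs W m a b e f c c'" and "c \<noteq> c'" and Q: "slater_eqs W b f"
  shows "dim_variety W < 2"
proof -
  \<comment> \<open>The two Saalschuetz equations and the Slater hyperplane, here
    \<open>w $ m + w $ a + w $ e = 2\<close>, are solved for \<open>w $ b\<close>,
    \<open>w $ e\<close> and \<open>w $ f\<close>.\<close>
  define \<beta> where "\<beta> = (\<lambda>(x::complex) (y::complex). c - x - y)"
  define \<gamma> where "\<gamma> = (\<lambda>x y::complex. 2 - x - y)"
  define \<delta> where "\<delta> = (\<lambda>(x::complex) (y::complex). c' - 2 + y)"
  define g :: "complex \<Rightarrow> complex \<Rightarrow> complex \<Rightarrow> complex \<Rightarrow> complex \<Rightarrow> complex" where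
    "g = (\<lambda>wm wa wb we wf. (1 + wb + wf)\<^sup>2 + 1 + wb\<^sup>2 + wf\<^sup>2 - wm\<^sup>2 - wa\<^sup>2 - we\<^sup>2)"
  \<comment> \<open>The restricted quadric is affine in \<open>y\<close> with slope
    \<open>2 * (c' - c)\<close>, so it cannot vanish at both points.\<close>
  have "g 0 1 (\<beta> 0 1) (\<gamma> 0 1) (\<delta> 0 1) - g 0 0 (\<beta> 0 0) (\<gamma> 0 0) (\<delta> 0 0) = 2 * (c' - c)"
    by (simp add: g_def \<beta>_def \<gamma>_def \<delta>_def power2_eq_square algebra_simps)
  moreover have "2 * (c' - c) \<noteq> 0" using \<open>c \<noteq> c'\<close> by simp
  ultimately obtain x y where nz: "g x y (\<beta> x y) (\<gamma> x y) (\<delta> x y) \<noteq> 0"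
    by (metis diff_self)
  show ?thesis
  proof (rule saalschuetz_eqs_param[where \<beta> = \<beta> and \<gamma> = \<gamma> and \<delta> = \<delta> and g = g and x = x and y = y])
    fix w assume w: "w \<in> W"
    note eqs = saalschuetz_eqsD(3,4)[OF S w]
    \<comment> \<open>Splitting into real and imaginary parts turns this into linear arithmetic over
      the reals.\<close>
    have eq3: "w $ m + w $ a + w $ e = 2" using slater_eqsD(1)[OF Q S w] by (simp add: complex_eq_iff)
    have eq4: "(1 + w $ b + w $ f)\<^sup>2 + 1 + 2 * ((w $ b)\<^sup>2 + (w $ f)\<^sup>2) =
        (w $ m)\<^sup>2 + (w $ a)\<^sup>2 + (w $ b)\<^sup>2 + (w $ e)\<^sup>2 + (w $ f)\<^sup>2"
      by (rule slater_eqsD(2)[OF Q S w])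
    have "w $ b = c - w $ m - w $ a" using eqs(1) by (simp add: complex_eq_iff)
    moreover have "w $ e = 2 - w $ m - w $ a" using eq3 by (simp add: complex_eq_iff)
    moreover have "w $ f = c' - 2 + w $ a" using eqs(2) eq3 by (simp add: complex_eq_iff)
    ultimately show "w $ b = \<beta> (w $ m) (w $ a) \<and> w $ e = \<gamma> (w $ m) (w $ a) \<and> w $ f = \<delta> (w $ m) (w $ a)"
      unfolding \<beta>_def \<gamma>_def \<delta>_def by blast
    from eq4 show "g (w $ m) (w $ a) (w $ b) (w $ e) (w $ f) = 0"
      unfolding g_def by (simp add: algebra_simps)
  qed (rule S, unfold \<beta>_def \<gamma>_def \<delta>_def g_def, (intro polynomial_fun_intros)+,
      rule nz[unfolded \<beta>_def \<gamma>_def \<delta>_def g_def])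
qed

text \<open>The shared index is now a Slater index. The parameter \<open>y = w $ a\<close> enters
  the quadric only through the squares of \<open>w $ a\<close> and \<open>w $ b\<close>, so
  \<open>y * y\<close> has coefficient -2 whatever \<open>c\<close> and \<open>c'\<close>
  are.\<close>

lemma dim_slater_saalschuetz_centre:
  assumes S: "saalschuetz_eqs W m a b e f c c'" and Q: "slater_eqs W m f"
  shows "dim_variety W < 2"
proof -
  define \<beta> where "\<beta> = (\<lambda>(x::complex) (y::complex). c - x - y)"
  define \<gamma> where "\<gamma> = (\<lambda>(x::complex) (y::complex). 2 - c + x)"
  define \<delta> where "\<delta> = (\<lambda>(x::complex) (y::complex). c + c' - 2 - 2 * x)"
  define g :: "complex \<Rightarrow> complex \<Rightarrow> complex \<Rightarrow> complex \<Rightarrow> complex \<Rightarrow> complex" where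
    "g = (\<lambda>wm wa wb we wf. (1 + wm + wf)\<^sup>2 + 1 + wm\<^sup>2 + wf\<^sup>2 - wa\<^sup>2 - wb\<^sup>2 - we\<^sup>2)"
  \<comment> \<open>The second difference in \<open>y\<close>, twice the coefficient -2; it would be
    0 if all three values vanished.\<close>
  have "g 0 1 (\<beta> 0 1) (\<gamma> 0 1) (\<delta> 0 1) + g 0 (-1) (\<beta> 0 (-1)) (\<gamma> 0 (-1)) (\<delta> 0 (-1)) -
      2 * g 0 0 (\<beta> 0 0) (\<gamma> 0 0) (\<delta> 0 0) = - 4"
    by (simp add: g_def \<beta>_def \<gamma>_def \<delta>_def power2_eq_square algebra_simps)
  then have "g 0 1 (\<beta> 0 1) (\<gamma> 0 1) (\<delta> 0 1) \<noteq> 0 \<or> g 0 (-1) (\<beta> 0 (-1)) (\<gamma> 0 (-1)) (\<delta> 0 (-1)) \<noteq> 0 \<or>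
      g 0 0 (\<beta> 0 0) (\<gamma> 0 0) (\<delta> 0 0) \<noteq> 0"
    by (auto simp del: diff_0)
  then obtain x y where nz: "g x y (\<beta> x y) (\<gamma> x y) (\<delta> x y) \<noteq> 0"
    by blast
  show ?thesis
  proof (rule saalschuetz_eqs_param[where \<beta> = \<beta> and \<gamma> = \<gamma> and \<delta> = \<delta> and g = g and x = x and y = y])
    fix w assume w: "w \<in> W"
    note eqs = saalschuetz_eqsD(3,4)[OF S w]
    have eq3: "w $ a + w $ b + w $ e = 2" using slater_eqsD(1)[OF Q S w] by (simp add: complex_eq_iff)
    have eq4: "(1 + w $ m + w $ f)\<^sup>2 + 1 + 2 * ((w $ m)\<^sup>2 + (w $ f)\<^sup>2) =
        (w $ m)\<^sup>2 + (w $ a)\<^sup>2 + (w $ b)\<^sup>2 + (w $ e)\<^sup>2 + (w $ f)\<^sup>2"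
      by (rule slater_eqsD(2)[OF Q S w])
    have "w $ b = c - w $ m - w $ a" using eqs(1) by (simp add: complex_eq_iff)
    moreover have "w $ e = 2 - c + w $ m" using eqs(1) eq3 by (simp add: complex_eq_iff)
    moreover have "w $ f = c + c' - 2 - 2 * w $ m" using eqs eq3 by (simp add: complex_eq_iff)
    ultimately show "w $ b = \<beta> (w $ m) (w $ a) \<and> w $ e = \<gamma> (w $ m) (w $ a) \<and> w $ f = \<delta> (w $ m) (w $ a)"
      unfolding \<beta>_def \<gamma>_def \<delta>_def by blast
    from eq4 show "g (w $ m) (w $ a) (w $ b) (w $ e) (w $ f) = 0"
      unfolding g_def by (simp add: algebra_simps)
  qed (rule S, unfold \<beta>_def \<gamma>_def \<delta>_def g_def, (intro polynomial_fun_intros)+,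
      rule nz[unfolded \<beta>_def \<gamma>_def \<delta>_def g_def])
qed

text \<open>Of the ten pairs \<open>{x, y}\<close>, the pairs \<open>{e, f}\<close> and
  \<open>{a, b}\<close> make the Slater hyperplane parallel to a Saalschuetz one, so
  \<open>W\<close> would be empty; four take one index from each of these pairs, and four contain
  \<open>m\<close>.\<close>

lemma dim_slater_saalschuetz:
  assumes S: "saalschuetz_eqs W m a b e f c c'" and Q: "slater_eqs W x y"
    and c: "c \<noteq> c'" "c \<noteq> 2" "c' \<noteq> 2" and "W \<noteq> {}"
  shows "dim_variety W < 2"
proof -
  obtain w where w: "w \<in> W" using \<open>W \<noteq> {}\<close> by blast
  note eqs = saalschuetz_eqsD(3,4)[OF S w] and * = slater_eqsD(1)[OF Q S w]
  note names = saalschuetz_eqsD(1)[OF S]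
  have "x \<noteq> y" using Q by (simp add: slater_eqs_def)
  note S' = S saalschuetz_eqs_swap[OF S] saalschuetz_eqs_swap(2)[OF saalschuetz_eqs_swap(1)[OF S]]
    saalschuetz_eqs_swap(2)[OF saalschuetz_eqs_swap(3)[OF S]]
  note Q' = Q slater_eqs_sym[OF Q]
  \<comment> \<open>The symmetries move the Slater indices to \<open>b\<close> and \<open>f\<close>
    here, and to \<open>m\<close> and \<open>f\<close> in \<open>centre\<close>.\<close>
  note mixed = S'(1,2,3,5)[THEN dim_slater_saalschuetz_mixed, OF c(1)]
  note centre = S'(1,3,4,6)[THEN dim_slater_saalschuetz_centre]
  have "x \<in> {e, f} \<Longrightarrow> y \<in> {e, f} \<Longrightarrow> False"
    using * eqs(1) c(2) \<open>x \<noteq> y\<close> by (auto simp: complex_eq_iff)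
  moreover have "x \<in> {a, b} \<Longrightarrow> y \<in> {a, b} \<Longrightarrow> False"
    using * eqs(2) c(3) \<open>x \<noteq> y\<close> by (auto simp: complex_eq_iff)
  ultimately show ?thesis
    using names[of x] names[of y] \<open>x \<noteq> y\<close> Q' mixed centre by (elim disjE; auto)
qed

section \<open>Dixon--Watson--Whipple planes against Pfaff--Saalschuetz planes\<close>

text \<open>Two pairs covering four elements form a perfect matching, and there are only three of
  these.\<close>

lemma pairings:
  assumes P: "P i j" "P k l" and sym: "\<And>x y. P x y \<Longrightarrow> P y x"
    and "{i, j, k, l} = {m, a, b, e}" "distinct [m, a, b, e]"
  shows "(P m a \<and> P b e) \<or> (P m b \<and> P a e) \<or> (P m e \<and> P a b)"
proof -
  have "distinct [i, j, k, l]"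
    using assms(4,5) by (metis card_distinct distinct_card length_Cons list.set(1,2) list.size(3))
  moreover have "m \<in> {i, j, k, l}" "a \<in> {i, j, k, l}" "b \<in> {i, j, k, l}" "e \<in> {i, j, k, l}"
    using assms(4) by auto
  ultimately show ?thesis using P sym assms(5) by auto
qed

text \<open>The index outside the matching is \<open>f\<close>. If \<open>m\<close> is matched with
  \<open>a\<close> or \<open>b\<close>, every coordinate is affine in \<open>w $ m\<close>; if
  \<open>m\<close> is matched with \<open>e\<close>, then \<open>w $ m\<close> is constant and
  \<open>w $ a\<close> is the parameter.\<close>

lemma dim_dixon_saalschuetz_outer:
  assumes S: "saalschuetz_eqs W m a b e f c c'"
    and P: "(P m a \<and> P b e) \<or> (P m b \<and> P a e) \<or> (P m e \<and> P a b)"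
    and P_def: "\<And>x y. P x y \<longleftrightarrow> (\<forall>w\<in>W. w $ x + w $ y = h)"
  shows "dim_variety W < 2"
proof -
  note names = saalschuetz_eqsD(1)[OF S]
  have *: "dim_variety W < 2"
    if S: "saalschuetz_eqs W m a b e f c c'" and P: "P m a" "P b e" for a b
  proof (rule dim_variety_affine_line[where j = m])
    note names = saalschuetz_eqsD(1)[OF S]
    fix i
    have "\<forall>w\<in>W. w $ m + w $ a + w $ b = c \<and> w $ m + w $ e + w $ f = c' \<and>
        w $ m + w $ a = h \<and> w $ b + w $ e = h"
      using S P unfolding P_def saalschuetz_eqs_def by blast
    then have "\<forall>w\<in>W. w $ m = 0 + 1 * w $ m \<and> w $ a = h + (-1) * w $ m \<and>
        w $ b = (c - h) + 0 * w $ m \<and> w $ e = (2 * h - c) + 0 * w $ m \<and>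
        w $ f = (c' - 2 * h + c) + (-1) * w $ m"
      by - (intro ballI conjI; drule (1) bspec; elim conjE; simp add: complex_eq_iff)
    then show "\<exists>\<alpha> \<beta>. \<forall>w\<in>W. w $ i = \<alpha> + \<beta> * w $ m"
      using names[of i] by (elim disjE) blast+
  qed
  have **: "dim_variety W < 2" if P: "P m e" "P a b"
  proof (rule dim_variety_affine_line[where j = a])
    fix i
    have "\<forall>w\<in>W. w $ m + w $ a + w $ b = c \<and> w $ m + w $ e + w $ f = c' \<and>
        w $ m + w $ e = h \<and> w $ a + w $ b = h"
      using S P unfolding P_def saalschuetz_eqs_def by blast
    then have "\<forall>w\<in>W. w $ m = (c - h) + 0 * w $ a \<and> w $ a = 0 + 1 * w $ a \<and>
        w $ b = h + (-1) * w $ a \<and> w $ e = (2 * h - c) + 0 * w $ a \<and>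
        w $ f = (c' - h) + 0 * w $ a"
      by - (intro ballI conjI; drule (1) bspec; elim conjE; simp add: complex_eq_iff)
    then show "\<exists>\<alpha> \<beta>. \<forall>w\<in>W. w $ i = \<alpha> + \<beta> * w $ a"
      using names[of i] by (elim disjE) blast+
  qed
  from P show ?thesis
    using *[OF S] *[OF saalschuetz_eqs_swap(1)[OF S]] ** by blast
qed

text \<open>The index outside the matching is \<open>m\<close>. Matching \<open>a\<close> with
  \<open>b\<close> gives \<open>c = w $ m + h = c'\<close>, a contradiction; the other two matchings
  leave a line with parameter \<open>w $ a\<close>.\<close>

lemma dim_dixon_saalschuetz_centre:
  assumes S: "saalschuetz_eqs W m a b e f c c'" and c: "c \<noteq> c'" and "W \<noteq> {}"
    and P: "(P a b \<and> P e f) \<or> (P a e \<and> P b f) \<or> (P a f \<and> P b e)"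
    and P_def: "\<And>x y. P x y \<longleftrightarrow> (\<forall>w\<in>W. w $ x + w $ y = h)"
  shows "dim_variety W < 2"
proof -
  have *: "dim_variety W < 2"
    if S: "saalschuetz_eqs W m a b e f c c'" and P: "P a e" "P b f" for e f
  proof (rule dim_variety_affine_line[where j = a])
    note names = saalschuetz_eqsD(1)[OF S]
    fix i
    \<comment> \<open>The sum of the Saalschuetz equations reads
      \<open>2 * w $ m + 2 * h = c + c'\<close>, so \<open>k\<close> is the constant value of
      \<open>w $ m\<close>.\<close>
    define k where "k = (c + c') / 2 - h"
    have "\<forall>w\<in>W. w $ m + w $ a + w $ b = c \<and> w $ m + w $ e + w $ f = c' \<and>
        w $ a + w $ e = h \<and> w $ b + w $ f = h"
      using S P unfolding P_def saalschuetz_eqs_def by blast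
    then have "\<forall>w\<in>W. w $ m = k + 0 * w $ a \<and> w $ a = 0 + 1 * w $ a \<and>
        w $ b = (c - k) + (-1) * w $ a \<and> w $ e = h + (-1) * w $ a \<and>
        w $ f = (h - c + k) + 1 * w $ a"
      unfolding k_def
      by - (intro ballI conjI; drule (1) bspec; elim conjE; auto simp: complex_eq_iff field_simps)
    then show "\<exists>\<alpha> \<beta>. \<forall>w\<in>W. w $ i = \<alpha> + \<beta> * w $ a"
      using names[of i] by (elim disjE) blast+
  qed
  have "\<not> (P a b \<and> P e f)"
  proof
    assume "P a b \<and> P e f"
    moreover obtain w where "w \<in> W" using \<open>W \<noteq> {}\<close> by blast
    ultimately have "w $ a + w $ b = h" "w $ e + w $ f = h"
      "w $ m + w $ a + w $ b = c" "w $ m + w $ e + w $ f = c'"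
      using S unfolding P_def saalschuetz_eqs_def by blast+
    then have "c = w $ m + h" "c' = w $ m + h" by (simp_all add: complex_eq_iff)
    then show False using c by simp
  qed
  then show ?thesis
    using P *[OF S] *[OF saalschuetz_eqs_swap(2)[OF S]] by blast
qed

definition dixon_eqs :: "(complex^5) set \<Rightarrow> complex \<Rightarrow> 5 \<Rightarrow> 5 \<Rightarrow> 5 \<Rightarrow> 5 \<Rightarrow> 5 \<Rightarrow> bool" where
  "dixon_eqs W h z i j k l \<longleftrightarrow> UNIV = {z, i, j, k, l} \<and> distinct [z, i, j, k, l] \<and>
     (\<forall>w\<in>W. w $ i + w $ j = h \<and> w $ k + w $ l = h)"

text \<open>The symmetries reduce the position of the unpaired index \<open>z\<close> to
  \<open>f\<close> or \<open>m\<close>.\<close>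

lemma dim_dixon_saalschuetz:
  assumes S: "saalschuetz_eqs W m a b e f c c'" and D: "dixon_eqs W h z i j k l"
    and c: "c \<noteq> c'" and W: "W \<noteq> {}"
  shows "dim_variety W < 2"
proof -
  define P where "P = (\<lambda>x y. \<forall>w\<in>W. w $ x + w $ y = h)"
  have P_iff: "P x y \<longleftrightarrow> (\<forall>w\<in>W. w $ x + w $ y = h)" for x y by (simp add: P_def)
  have P: "P i j" "P k l" and sym: "\<And>x y. P x y \<Longrightarrow> P y x"
    using D by (auto simp: P_def dixon_eqs_def add.commute)
  have rest: "{i, j, k, l} = - {z}" using D unfolding dixon_eqs_def by auto
  have outer: "dim_variety W < 2"
    if S: "saalschuetz_eqs W m a b e f c c'" and "z = f" for a b e f c c'
  proof -
    have "- {z} = {m, a, b, e}" "distinct [m, a, b, e]"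
      using S \<open>z = f\<close> unfolding saalschuetz_eqs_def by auto
    then show ?thesis
      using dim_dixon_saalschuetz_outer[OF S pairings[of P, OF P sym] P_iff] rest by simp
  qed
  consider "z = f" | "z = e" | "z = b" | "z = a" | "z = m"
    using S unfolding saalschuetz_eqs_def by blast
  then show ?thesis
  proof cases
    case 1 then show ?thesis by (rule outer[OF S])
  next
    case 2 then show ?thesis by (rule outer[OF saalschuetz_eqs_swap(2)[OF S]])
  next
    case 3 then show ?thesis by (rule outer[OF saalschuetz_eqs_swap(3)[OF S]])
  next
    case 4 then show ?thesis
      by (rule outer[OF saalschuetz_eqs_swap(3)[OF saalschuetz_eqs_swap(1)[OF S]]])
  next
    case 5
    then have "- {z} = {a, b, e, f}" "distinct [a, b, e, f]"
      using S unfolding saalschuetz_eqs_def by auto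
    then show ?thesis
      using dim_dixon_saalschuetz_centre[OF S c W pairings[of P, OF P sym] P_iff] rest by simp
  qed
qed

section \<open>Orbit members in symmetric coordinates\<close>

lemma bij_5_names:
  assumes "bij (\<tau> :: 5 \<Rightarrow> 5)"
  shows "UNIV = {\<tau> 1, \<tau> 2, \<tau> 3, \<tau> 4, \<tau> 5}" "distinct [\<tau> 1, \<tau> 2, \<tau> 3, \<tau> 4, \<tau> 5]"
proof -
  have "UNIV = \<tau> ` UNIV" using assms by (simp add: bij_is_surj)
  then show "UNIV = {\<tau> 1, \<tau> 2, \<tau> 3, \<tau> 4, \<tau> 5}" by (simp add: UNIV_5)
  show "distinct [\<tau> 1, \<tau> 2, \<tau> 3, \<tau> 4, \<tau> 5]"
    using bij_is_inj[OF assms] by (simp add: inj_eq)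
qed

text \<open>In symmetric coordinates \<open>a\<close> is \<open>x + u + v\<close> and
  \<open>d + e - a - b - c\<close> is \<open>x + y + z\<close>: two triples sharing
  \<open>x\<close>.\<close>

lemma pfaff_saalschuetz_orbit_eqs:
  assumes "V \<in> pfaff_saalschuetz_orbit n" "Z \<subseteq> V"
  shows "\<exists>m a b e f. saalschuetz_eqs (sym_coords ` Z) m a b e f 1 (- of_int n)"
proof -
  obtain \<tau> where \<tau>: "bij \<tau>" "\<And>p. p \<in> V \<longleftrightarrow> permute_coords \<tau> p \<in> pfaff_saalschuetz_plane n"
    using assms(1) in_thomae_orbitD(1) unfolding orbit_eqs by blast
  have "saalschuetz_eqs (sym_coords ` Z) (\<tau> 1) (\<tau> 2) (\<tau> 3) (\<tau> 4) (\<tau> 5) 1 (- of_int n)"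
    unfolding saalschuetz_eqs_def
  proof (intro conjI ballI bij_5_names[OF \<tau>(1)])
    fix w assume "w \<in> sym_coords ` Z"
    then obtain p where p: "p \<in> V" "w = sym_coords p" using assms(2) by blast
    have mem: "permute_coords \<tau> p \<in> pfaff_saalschuetz_plane n" using \<tau>(2) p(1) by blast
    let ?x = "w $ \<tau> 1" and ?y = "w $ \<tau> 2" and ?z = "w $ \<tau> 3" and ?u = "w $ \<tau> 4" and ?v = "w $ \<tau> 5"
    have "?x + ?u + ?v = - of_int n \<and> (?x + ?y + ?z + 2 * ?u + ?v) + (?x + ?y + ?z + ?u + 2 * ?v) -
        (?x + ?u + ?v) - (?y + ?u + ?v) - (?z + ?u + ?v) = 1"
      using mem unfolding pfaff_saalschuetz_plane_def permute_coords_def mem_Collect_eq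
        thomae_matrix_nth vec_lambda_beta p(2) .
    then show "?x + ?y + ?z = 1" "?x + ?u + ?v = - of_int n" by (simp_all add: complex_eq_iff)
  qed
  then show ?thesis by blast
qed

text \<open>With \<open>r = y + u\<close> and \<open>s = z + v\<close> the equations read
  \<open>2 * r + s = 1\<close> and \<open>r + 2 * s = 1\<close>, so both are 1/3, and
  \<open>x\<close> is unpaired.\<close>

lemma dixon_watson_whipple_orbit_eqs:
  assumes "V \<in> dixon_watson_whipple_orbit" "Z \<subseteq> V"
  shows "\<exists>z i j k l. dixon_eqs (sym_coords ` Z) (1/3) z i j k l"
proof -
  obtain \<tau> where \<tau>: "bij \<tau>" "\<And>p. p \<in> V \<longleftrightarrow> permute_coords \<tau> p \<in> dixon_watson_whipple_plane"
    using assms(1) in_thomae_orbitD(1) unfolding orbit_eqs by blast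
  have "dixon_eqs (sym_coords ` Z) (1/3) (\<tau> 1) (\<tau> 2) (\<tau> 4) (\<tau> 3) (\<tau> 5)"
    unfolding dixon_eqs_def
  proof (intro conjI ballI)
    show "UNIV = {\<tau> 1, \<tau> 2, \<tau> 4, \<tau> 3, \<tau> 5}" "distinct [\<tau> 1, \<tau> 2, \<tau> 4, \<tau> 3, \<tau> 5]"
      using bij_5_names[OF \<tau>(1)] by auto
    fix w assume "w \<in> sym_coords ` Z"
    then obtain p where p: "p \<in> V" "w = sym_coords p" using assms(2) by blast
    have mem: "permute_coords \<tau> p \<in> dixon_watson_whipple_plane" using \<tau>(2) p(1) by blast
    let ?x = "w $ \<tau> 1" and ?y = "w $ \<tau> 2" and ?z = "w $ \<tau> 3" and ?u = "w $ \<tau> 4" and ?v = "w $ \<tau> 5"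
    have "?x + ?y + ?z + 2 * ?u + ?v = 1 + (?x + ?u + ?v) - (?y + ?u + ?v) \<and>
       ?x + ?y + ?z + ?u + 2 * ?v = 1 + (?x + ?u + ?v) - (?z + ?u + ?v)"
      using mem unfolding dixon_watson_whipple_plane_def permute_coords_def mem_Collect_eq
        thomae_matrix_nth vec_lambda_beta p(2) .
    then show "?y + ?u = 1/3" "?z + ?v = 1/3" by (simp_all add: complex_eq_iff)
  qed
  then show ?thesis by blast
qed

lemma slater_orbit_eqs:
  assumes "V \<in> slater_orbit" "Z \<subseteq> V"
  shows "\<exists>x y. slater_eqs (sym_coords ` Z) x y"
proof -
  obtain \<tau> where \<tau>: "bij \<tau>" "\<And>p. p \<in> V \<longleftrightarrow> permute_coords \<tau> p \<in> slater_variety"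
    using assms(1) in_thomae_orbitD(1) unfolding orbit_eqs by blast
  have sum: "(\<Sum>i\<in>UNIV. h i) = h (\<tau> 1) + h (\<tau> 2) + h (\<tau> 3) + h (\<tau> 4) + h (\<tau> 5)" for h :: "5 \<Rightarrow> complex"
    using sum.reindex_bij_betw[OF \<tau>(1), of h] by (simp add: sum_5)
  have "slater_eqs (sym_coords ` Z) (\<tau> 4) (\<tau> 5)"
    unfolding slater_eqs_def sum
  proof (intro conjI ballI)
    show "\<tau> 4 \<noteq> \<tau> 5" using bij_5_names[OF \<tau>(1)] by simp
    fix w assume "w \<in> sym_coords ` Z"
    then obtain p where p: "p \<in> V" "w = sym_coords p" using assms(2) by blast
    have mem: "permute_coords \<tau> p \<in> slater_variety" using \<tau>(2) p(1) by blast
    let ?x = "w $ \<tau> 1" and ?y = "w $ \<tau> 2" and ?z = "w $ \<tau> 3" and ?u = "w $ \<tau> 4" and ?v = "w $ \<tau> 5"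
    have *: "(?x + ?u + ?v) * (?y + ?u + ?v) + (?y + ?u + ?v) * (?z + ?u + ?v) +
        (?z + ?u + ?v) * (?x + ?u + ?v) = (?x + ?y + ?z + 2 * ?u + ?v - 1) * (?x + ?y + ?z + ?u + 2 * ?v - 1) \<and>
        (?x + ?y + ?z + 2 * ?u + ?v) + (?x + ?y + ?z + ?u + 2 * ?v) -
        (?x + ?u + ?v) - (?y + ?u + ?v) - (?z + ?u + ?v) = 2"
      using mem unfolding slater_variety_def permute_coords_def mem_Collect_eq
        thomae_matrix_nth vec_lambda_beta p(2) .
    then show "?x + ?y + ?z + ?u + ?v - ?u - ?v = 2" by (simp add: complex_eq_iff)
    \<comment> \<open>Since \<open>x + y + z = 2\<close>, the sum
      \<open>x * y + y * z + z * x\<close> is half of 4 minus the squares of \<open>x\<close>,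
      \<open>y\<close>, \<open>z\<close>; this turns the quadric into a relation between
      squares.\<close>
    have "(1 + u + v)\<^sup>2 + 1 + 2 * (u\<^sup>2 + v\<^sup>2) = x\<^sup>2 + y\<^sup>2 + z\<^sup>2 + u\<^sup>2 + v\<^sup>2"
      if "(x + u + v) * (y + u + v) + (y + u + v) * (z + u + v) +
        (z + u + v) * (x + u + v) = (x + y + z + 2 * u + v - 1) * (x + y + z + u + 2 * v - 1)"
       "(x + y + z + 2 * u + v) + (x + y + z + u + 2 * v) -
        (x + u + v) - (y + u + v) - (z + u + v) = 2" for x y z u v :: complex
      using that by algebra
    then show "(1 + ?u + ?v)\<^sup>2 + 1 + 2 * (?u\<^sup>2 + ?v\<^sup>2) = ?x\<^sup>2 + ?y\<^sup>2 + ?z\<^sup>2 + ?u\<^sup>2 + ?v\<^sup>2"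
      using * by blast
  qed
  then show ?thesis by blast
qed

lemma dim_sym_coords_image: "dim_variety Z \<le> dim_variety (sym_coords ` Z)"
  by (rule dim_variety_embedding[where \<psi> = "\<lambda>w. w v* thomae_matrix"])
    (simp_all add: sym_coords_def[abs_def] polynomial_map_vector_matrix_mult
      sym_coords_inverse[unfolded sym_coords_def])

section \<open>From dimension bounds to orbits\<close>

text \<open>A component of dimension at most 1 would give \<open>3 + 3 < 1 + 5\<close>; its
  dimension is bounded after passing to symmetric coordinates.\<close>

lemma not_intersect_improperly:
  assumes "3 \<le> dim_variety V" "3 \<le> dim_variety W"
    and "\<And>Z. Z \<noteq> {} \<Longrightarrow> Z \<subseteq> V \<inter> W \<Longrightarrow> dim_variety (sym_coords ` Z) < 2"
  shows "\<not> intersect_improperly V W"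
proof
  assume "intersect_improperly V W"
  then obtain Z where Z: "irreducible_component Z (V \<inter> W)"
    "dim_variety V + dim_variety W < dim_variety Z + 5"
    unfolding intersect_improperly_def by blast
  then have "Z \<noteq> {}" "Z \<subseteq> V \<inter> W"
    by (simp_all add: irreducible_component_def irreducible_variety_def)
  have "dim_variety Z < 2"
    using dim_sym_coords_image assms(3)[OF \<open>Z \<noteq> {}\<close> \<open>Z \<subseteq> V \<inter> W\<close>] by (rule le_less_trans)
  then have "dim_variety Z + 5 \<le> 6"
    by (cases "dim_variety Z") (auto simp: numeral_eq_enat)
  also have "(6 :: enat) = 3 + 3" by simp
  also have "\<dots> \<le> dim_variety V + dim_variety W" using assms(1,2) by (rule add_mono)
  finally show False using Z(2) by simp
qed

theorem theorem3p5:
  shows "orbits_intersect_improperly slater_orbit dixon_watson_whipple_orbit \<and>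
    (\<forall>n::int. n \<ge> 1 \<longrightarrow>
       \<not> orbits_intersect_improperly slater_orbit (pfaff_saalschuetz_orbit n)) \<and>
    (\<forall>n::int. n \<ge> 1 \<longrightarrow>
       \<not> orbits_intersect_improperly dixon_watson_whipple_orbit (pfaff_saalschuetz_orbit n))"
proof (intro conjI allI impI)
  show "orbits_intersect_improperly slater_orbit dixon_watson_whipple_orbit"
    unfolding orbits_intersect_improperly_def orbit_eqs
    using slater_dixon_intersect_improperly in_thomae_orbit_self by blast
next
  fix n :: int assume n: "n \<ge> 1"
  \<comment> \<open>The constants of \<open>x + y + z = 1\<close> and \<open>x + u + v = -n\<close>
    must differ from each other and from the Slater constant 2; \<open>n \<ge> 1\<close> makes
    \<open>-n\<close> negative.\<close>
  then have c: "(1::complex) \<noteq> - of_int n" "(1::complex) \<noteq> 2" "- of_int n \<noteq> (2::complex)"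
    by (simp_all add: complex_eq_iff)
  have dims: "V \<in> slater_orbit \<Longrightarrow> 3 \<le> dim_variety V"
    "V \<in> dixon_watson_whipple_orbit \<Longrightarrow> 3 \<le> dim_variety V"
    "V \<in> pfaff_saalschuetz_orbit n \<Longrightarrow> 3 \<le> dim_variety V" for V
    using in_thomae_orbitD(2) dim_slater_variety dixon_watson_whipple_plane(2)
      dim_pfaff_saalschuetz_plane unfolding orbit_eqs by metis+
  show "\<not> orbits_intersect_improperly slater_orbit (pfaff_saalschuetz_orbit n)"
  proof -
    have "\<not> intersect_improperly V W" if VW: "V \<in> slater_orbit" "W \<in> pfaff_saalschuetz_orbit n" for V W
    proof (rule not_intersect_improperly)
      fix Z assume Z: "Z \<noteq> {}" "Z \<subseteq> V \<inter> W"
      then obtain x y m a b e f where "slater_eqs (sym_coords ` Z) x y"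
        "saalschuetz_eqs (sym_coords ` Z) m a b e f 1 (- of_int n)"
        using slater_orbit_eqs[OF VW(1), of Z] pfaff_saalschuetz_orbit_eqs[OF VW(2), of Z]
        by blast
      then show "dim_variety (sym_coords ` Z) < 2"
        using dim_slater_saalschuetz c Z(1) by blast
    qed (use VW dims in auto)
    then show ?thesis unfolding orbits_intersect_improperly_def by blast
  qed
  show "\<not> orbits_intersect_improperly dixon_watson_whipple_orbit (pfaff_saalschuetz_orbit n)"
  proof -
    have "\<not> intersect_improperly V W"
      if VW: "V \<in> dixon_watson_whipple_orbit" "W \<in> pfaff_saalschuetz_orbit n" for V W
    proof (rule not_intersect_improperly)
      fix Z assume Z: "Z \<noteq> {}" "Z \<subseteq> V \<inter> W"
      then obtain z i j k l m a b e f where "dixon_eqs (sym_coords ` Z) (1/3) z i j k l"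
        "saalschuetz_eqs (sym_coords ` Z) m a b e f 1 (- of_int n)"
        using dixon_watson_whipple_orbit_eqs[OF VW(1), of Z]
          pfaff_saalschuetz_orbit_eqs[OF VW(2), of Z] by blast
      then show "dim_variety (sym_coords ` Z) < 2"
        using dim_dixon_saalschuetz c(1) Z(1) by blast
    qed (use VW dims in auto)
    then show ?thesis unfolding orbits_intersect_improperly_def by blast
  qed
qed

end
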